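(* Let $d,n\in\mathbb N$ and let $V\subseteq C^{2^-\text{-var}}(\mathbb R^d)$ be a path variety. Then the set of all $X\in C^{2^-\text{-var}}(\mathbb R^d)$ such that $X^{\sqcup n}\in V$ is a path variety in $C^{2^-\text{-var}}(\mathbb R^d)$, and the set of all paths $(X_1,\dots,X_n)\in C^{2^-\text{-var}}(\mathbb R^{nd})$ (with each $X_i$ a path in $\mathbb R^d$) such that $X_1\sqcup\dots\sqcup X_n\in V$ is a path variety in $C^{2^-\text{-var}}(\mathbb R^{nd})$.
   Context: For $d\in\mathbb N$, $C^{2^-\text{-var}}(\mathbb R^d)$ is the set of all continuous $X:[0,T]\to\mathbb R^d$, with $T\in(0,\infty)$ depending on $X$, that have finite $p$-variation for some $p\in[1,2)$, i.e. $\big(\sup_P\sum_{[s,t]\in P}\|X_t-X_s\|_2^p\big)^{1/p}<\infty$ (supremum over partitions $P$ of $[0,T]$). Its elements are called paths. $T(\mathbb R^d)=\bigoplus_{n\ge0}(\mathbb R^d)^{\otimes n}$ is identified with the real vector space spanned by the words in the letters $1,\dots,d$, including the empty word $\mathsf e$; $T((\mathbb R^d))$ is its linear dual. The signature $\sigma(X)\in T((\mathbb R^d))$ is given by $\langle\sigma(X),\mathsf e\rangle=1$ and $\langle\sigma(X),i_1\cdots i_n\rangle=\int_{0<t_1<\dots<t_n<T}dX^{[i_1]}_{t_1}\cdots dX^{[i_n]}_{t_n}$ (iterated Riemann–Stieltjes integrals). A path variety is a set of the form $\mathcal V(W)=\{X\in C^{2^-\text{-var}}(\mathbb R^d)\mid\langle\sigma(X),x\rangle=0\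 \forall x\in W\}$ with $W\subseteq T(\mathbb R^d)$. For paths $X$ on $[0,T_1]$, $Y$ on $[0,T_2]$, the concatenation $X\sqcup Y$ on $[0,T_1+T_2]$ is $(X\sqcup Y)_t=X_t$ for $t\le T_1$ and $(X\sqcup Y)_t=Y_{t-T_1}+X_{T_1}-Y_0$ for $t>T_1$; $X^{\sqcup n}$ is the $n$-fold concatenation of $X$ with itself. *)

theory Defs
  imports "HOL-Analysis.Analysis" "HOL-Library.Poly_Mapping"
begin

section \<open>Paths\<close>

text \<open>
  The statement relates $\mathbf{R}^d$ and $\mathbf{R}^{nd}$ for natural numbers $d$, $n$, so
  $\mathbf{R}^d$ is a carrier set: the functions on the natural numbers that vanish outside
  $\{0,\dots,d-1\}$. Coordinates and letters are numbered from 0. On the carrier, the product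
  topology of the function type is the Euclidean topology.
\<close>

definition rvec :: "nat \<Rightarrow> (nat \<Rightarrow> real) set" where
  "rvec d = {v. \<forall>i\<ge>d. v i = 0}"

text \<open>
  A path \<open>X\<close> is the pair of its end time \<open>T\<close> and a function on $[0,T]$; the latter is
  \<open>undefined\<close> outside $[0,T]$, so that equality of pairs is equality of paths.
\<close>

type_synonym path = "real \<times> (real \<Rightarrow> nat \<Rightarrow> real)"

abbreviation end_time :: "path \<Rightarrow> real" where
  "end_time \<equiv> fst"

abbreviation path_at :: "path \<Rightarrow> real \<Rightarrow> nat \<Rightarrow> real" where
  "path_at \<equiv> snd"

text \<open>
  Members of a \<^const>\<open>division_of\<close> are compact intervals $K = [s,t]$, with $s$ = \<open>Inf K\<close> and
  $t$ = \<open>Sup K\<close>. Degenerate intervals are allowed there and contribute 0 to the sums below.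
\<close>

definition finite_p_variation :: "nat \<Rightarrow> real \<Rightarrow> path \<Rightarrow> bool" where
  "finite_p_variation d p X \<longleftrightarrow>
     bdd_above {(\<Sum>K\<in>P. L2_set (\<lambda>i. path_at X (Sup K) i - path_at X (Inf K) i) {..<d} powr p)
                | P. P division_of {0..end_time X}}"

definition paths :: "nat \<Rightarrow> path set" where
  "paths d = {X. end_time X > 0 \<and>
                 path_at X \<in> {0..end_time X} \<rightarrow>\<^sub>E rvec d \<and>
                 continuous_on {0..end_time X} (path_at X) \<and>
                 (\<exists>p. 1 \<le> p \<and> p < 2 \<and> finite_p_variation d p X)}"

definition path_concat :: "path \<Rightarrow> path \<Rightarrow> path"  (infixl "\<squnion>\<^sub>p" 65) where
  "X \<squnion>\<^sub>p Y =
     (end_time X + end_time Y,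
      \<lambda>t\<in>{0..end_time X + end_time Y}.
        if t \<le> end_time X then path_at X t
        else (\<lambda>i. path_at Y (t - end_time X) i + path_at X (end_time X) i - path_at Y 0 i))"

text \<open>$X_1 \sqcup \dots \sqcup X_n$; only meaningful for nonempty lists.\<close>

definition path_concat_list :: "path list \<Rightarrow> path" where
  "path_concat_list Xs = foldl (\<squnion>\<^sub>p) (hd Xs) (tl Xs)"

definition path_power :: "nat \<Rightarrow> path \<Rightarrow> path" where
  "path_power n X = path_concat_list (replicate n X)"

text \<open>
  A path in $\mathbf{R}^{nd}$ is a tuple of $n$ paths in $\mathbf{R}^d$ with a common end time; the
  component with number \<open>k\<close> (from 0) has the coordinates $kd,\dots,kd+d-1$.
\<close>

definition path_component_at :: "nat \<Rightarrow> nat \<Rightarrow> path \<Rightarrow> path" where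
  "path_component_at d k X =
     (end_time X, \<lambda>t\<in>{0..end_time X}. \<lambda>i. if i < d then path_at X t (k * d + i) else 0)"


section \<open>Riemann--Stieltjes integrals and the signature\<close>

definition has_rs_integral ::
    "(real \<Rightarrow> real) \<Rightarrow> (real \<Rightarrow> real) \<Rightarrow> real \<Rightarrow> real \<Rightarrow> real \<Rightarrow> bool" where
  "has_rs_integral f g a b I \<longleftrightarrow>
     (\<forall>e>0. \<exists>\<delta>>0. \<forall>P. P tagged_division_of {a..b} \<and> (\<forall>(x, K)\<in>P. Sup K - Inf K < \<delta>) \<longrightarrow>
        \<bar>(\<Sum>(x, K)\<in>P. f x * (g (Sup K) - g (Inf K))) - I\<bar> < e)"

definition rs_integral :: "(real \<Rightarrow> real) \<Rightarrow> (real \<Rightarrow> real) \<Rightarrow> real \<Rightarrow> real \<Rightarrow> real" where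
  "rs_integral f g a b = (THE I. has_rs_integral f g a b I)"

text \<open>
  Words are lists of letters. In the iterated integral the last letter belongs to the outermost
  integration variable, hence the recursion on the reversed word:
  \<open>iterated_integral X [i\<^sub>n, \<dots>, i\<^sub>1] t\<close> is the integral over $0 < t_1 < \dots < t_n < t$.
\<close>

primrec iterated_integral :: "path \<Rightarrow> nat list \<Rightarrow> real \<Rightarrow> real" where
  "iterated_integral X [] t = 1"
| "iterated_integral X (i # w) t =
     rs_integral (iterated_integral X w) (\<lambda>s. path_at X s i) 0 t"

text \<open>
  $T((\mathbf{R}^d))$, the linear dual of $T(\mathbf{R}^d)$, is given by the values on words;
  \<open>dual_pairing\<close> is the linear extension.
\<close>

definition signature :: "path \<Rightarrow> nat list \<Rightarrow> real" where
  "signature X w = iterated_integral X (rev w) (end_time X)"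

definition tensor_algebra :: "nat \<Rightarrow> (nat list \<Rightarrow>\<^sub>0 real) set" where
  "tensor_algebra d = {x. Poly_Mapping.keys x \<subseteq> lists {..<d}}"

definition dual_pairing :: "(nat list \<Rightarrow> real) \<Rightarrow> (nat list \<Rightarrow>\<^sub>0 real) \<Rightarrow> real" where
  "dual_pairing \<phi> x = (\<Sum>w\<in>Poly_Mapping.keys x. Poly_Mapping.lookup x w * \<phi> w)"


section \<open>Path varieties\<close>

definition path_variety_of :: "nat \<Rightarrow> (nat list \<Rightarrow>\<^sub>0 real) set \<Rightarrow> path set" where
  "path_variety_of d W = {X \<in> paths d. \<forall>x\<in>W. dual_pairing (signature X) x = 0}"

definition path_variety :: "nat \<Rightarrow> path set \<Rightarrow> bool" where
  "path_variety d V \<longleftrightarrow> (\<exists>W\<subseteq>tensor_algebra d. V = path_variety_of d W)"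

end

(*
  Along a path of finite p-variation with p < 2 there is a continuous strictly increasing control
  phi such that increments of the coordinates are O((increment of phi)^alpha) with alpha > 1/2.
  Young integration then becomes a calculus modulo O((increment of phi)^(2 alpha)): by the sewing
  lemma, G is an indefinite integral of f against g iff the increments of G agree with f dg up to
  such an error, and a function whose increments are negligible is constant. This yields the
  shuffle identity (from the product rule) and Chen's identity (by gluing at the junction).
  By Chen, a coefficient of the signature of a concatenation is a polynomial in coefficients of
  the signatures of the pieces; by the shuffle identity such a polynomial is a linear functional
  of the signature of X, so the preimage of a path variety is cut out by linear equations.
*)
theory Submission
  imports Defs
begin

section \<open>Sewing on the unit interval\<close>

text \<open>The paths need not have bounded variation, so no measure stands behind dX and product
  rules cannot be imported. What replaces them is that errors of order (\<Delta>\<phi>)^(2 \<alpha>)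
  with 2 \<alpha> > 1 sum to 0 along fine partitions; each identity is thereby reduced to a
  first-order expansion on an arbitrary subinterval. The control is \<open>W t + t\<close>, where
  \<open>W t\<close> is the supremum of q-variation sums on [0,t], p < q < 2 and \<alpha> = 1/q.
  Passing from p to q buys continuity, the summand \<open>t\<close> buys strictness. Strictness
  makes \<phi> a time change onto an interval, so sewing has to be proved only for powers of t - s
  on [0,1], where dyadic grids are available. Continuity turns a small mesh into small increments of
  \<phi>. Two paths are joined by joining their controls, after both exponents have been lowered to
  a common one. The coefficient of the empty word is 1, so constants are linear functionals of the
  signature as well.\<close>

lemma nat_floor_grid:
  fixes t :: real and n :: nat
  assumes "0 \<le> t"
  defines "k \<equiv> nat \<lfloor>2^n * t\<rfloor>"
  shows "real k / 2^n \<le> t" and "t < real (Suc k) / 2^n"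
proof -
  have nn: "0 \<le> \<lfloor>2^n * t\<rfloor>"
    using assms by simp
  then have k: "real k = of_int \<lfloor>2^n * t\<rfloor>"
    unfolding k_def by simp
  have "real k \<le> 2^n * t" "2^n * t < real k + 1"
    unfolding k by linarith+
  then show "real k / 2^n \<le> t" and "t < real (Suc k) / 2^n"
    by (auto simp: field_simps)
qed

definition grid_sum :: "(real \<Rightarrow> real \<Rightarrow> real) \<Rightarrow> nat \<Rightarrow> real \<Rightarrow> real" where
  "grid_sum \<Xi> n t =
     (\<Sum>i<nat \<lfloor>2^n * t\<rfloor>. \<Xi> (real i / 2^n) (real (Suc i) / 2^n)) +
     \<Xi> (real (nat \<lfloor>2^n * t\<rfloor>) / 2^n) t"

lemma dyadic_scale:
  fixes h :: real
  assumes "0 < h" "h \<le> 1"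
  obtains n where "h \<le> 1 / 2^n" "1 / 2^n < 2 * h"
proof -
  have "\<exists>n. 1 / 2^n < 2 * h"
    using real_arch_pow_inv[of "2*h" "1/2"] assms by (auto simp: power_one_over)
  define n where "n = (LEAST n. 1 / 2^n < 2 * h)"
  have 1: "1 / 2^n < 2 * h"
    unfolding n_def by (rule LeastI_ex) fact
  have "h \<le> 1 / 2^n"
  proof (cases n)
    case 0 then show ?thesis using assms by simp
  next
    case (Suc m)
    then have "\<not> 1 / 2^m < 2 * h"
      using not_less_Least[of m "\<lambda>n. 1 / 2^n < 2 * h"] unfolding n_def by simp
    then show ?thesis using Suc by (simp add: field_simps)
  qed
  with 1 show ?thesis using that by blast
qed

text \<open>Halving the cells of the dyadic grid changes the sum by one defect per cell: about
  \<open>2^n\<close> defects of size \<open>K * q^n\<close> with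
  \<open>q = 2 powr (-\<theta>)\<close>. Since \<open>2 * q < 1\<close>, the sums converge
  geometrically. The same count restricted to [s,t], begun at the grid level of size t - s, gives
  the error bound.\<close>

lemma sewing:
  fixes \<Xi> :: "real \<Rightarrow> real \<Rightarrow> real"
  assumes \<theta>: "\<theta> > 1"
    and defect: "\<And>s u t. 0 \<le> s \<Longrightarrow> s \<le> u \<Longrightarrow> u \<le> t \<Longrightarrow> t \<le> 1 \<Longrightarrow>
      \<bar>\<Xi> s u + \<Xi> u t - \<Xi> s t\<bar> \<le> K * (t - s) powr \<theta>"
  obtains F C where "\<And>s t. 0 \<le> s \<Longrightarrow> s \<le> t \<Longrightarrow> t \<le> 1 \<Longrightarrow>
      \<bar>F t - F s - \<Xi> s t\<bar> \<le> C * (t - s) powr \<theta>"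
proof -
  define q where "q = (2::real) powr (-\<theta>)"
  have q0: "q > 0" unfolding q_def by simp
  have q1: "2 * q < 1"
  proof -
    have "2 * q = 2 powr (1 - \<theta>)"
      unfolding q_def by (simp add: powr_diff powr_minus divide_inverse)
    also have "\<dots> < 2 powr 0" using \<theta> by (intro powr_less_mono) auto
    finally show ?thesis by simp
  qed
  have scale: "(1 / 2^n) powr \<theta> = q^n" for n
  proof -
    have "(1 / 2^n :: real) = 2 powr (- real n)"
      by (simp add: powr_minus powr_realpow divide_inverse)
    then have "(1 / 2^n :: real) powr \<theta> = 2 powr (- real n * \<theta>)"
      by (simp add: powr_powr)
    also have "\<dots> = (2 powr (-\<theta>)) powr (real n)"
      by (simp add: powr_powr mult.commute)
    also have "\<dots> = q^n" unfolding q_def by (simp add: powr_realpow)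
    finally show ?thesis .
  qed
  have K0: "K \<ge> 0"
    using order_trans[OF abs_ge_zero defect[of 0 0 1]] by simp
  have defect': "\<bar>\<Xi> s u + \<Xi> u t - \<Xi> s t\<bar> \<le> K * q^n"
    if "0 \<le> s" "s \<le> u" "u \<le> t" "t \<le> 1" "t - s \<le> 1 / 2^n" for s u t n
  proof -
    have "(t - s) powr \<theta> \<le> (1 / 2^n) powr \<theta>"
      using that \<theta> by (intro powr_mono2) auto
    then have "K * (t - s) powr \<theta> \<le> K * q^n"
      using K0 scale by (simp add: mult_left_mono)
    with defect[OF that(1-4)] show ?thesis by simp
  qed
  have diag: "\<Xi> s s = 0" if "0 \<le> s" "s \<le> 1" for s
    using defect[of s s s] that by simp
  define F where "F = grid_sum \<Xi>"
  define k where "k = (\<lambda>n (t::real). nat \<lfloor>2^n * t\<rfloor>)"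
  define g where "g = (\<lambda>n i. real i / 2^n)"
  have F: "F n t = (\<Sum>i<k n t. \<Xi> (g n i) (g n (Suc i))) + \<Xi> (g n (k n t)) t" for n t
    unfolding F_def grid_sum_def k_def g_def ..
  have kb: "g n (k n t) \<le> t" "t < g n (Suc (k n t))" if "0 \<le> t" for n t
    using nat_floor_grid[OF that] unfolding k_def g_def by auto
  have gap: "g n (Suc i) - g n i = 1 / 2^n" for n i
    unfolding g_def by (simp add: field_simps)
  have gdouble: "g (Suc n) (2 * i) = g n i" for n i
    unfolding g_def by simp
  have gdouble': "g (Suc n) (Suc (Suc (2 * i))) = g n (Suc i)" for n i
    using gdouble[of n "Suc i"] by simp
  have gless: "g n i < g n j \<longleftrightarrow> i < j" for n i j
    unfolding g_def by (simp add: field_simps)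
  have gle: "g n i \<le> g n j \<longleftrightarrow> i \<le> j" for n i j
    unfolding g_def by (simp add: field_simps)
  have g0: "0 \<le> g n i" for n i unfolding g_def by simp
  \<comment> \<open>Under refinement the last grid point before \<open>t\<close> stays or moves to
    the midpoint of the incomplete cell.\<close>
  have kdouble: "k (Suc n) t = 2 * k n t \<or> k (Suc n) t = Suc (2 * k n t)" if "0 \<le> t" for n t
  proof -
    have "g (Suc n) (2 * k n t) < g (Suc n) (Suc (k (Suc n) t))"
      using kb(1)[OF that, of n] kb(2)[OF that, of "Suc n"] gdouble[of n "k n t"] by simp
    moreover have "g (Suc n) (k (Suc n) t) < g (Suc n) (Suc (Suc (2 * k n t)))"
      using kb(2)[OF that, of n] kb(1)[OF that, of "Suc n"] gdouble'[of n "k n t"] by simp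
    ultimately show ?thesis unfolding gless by linarith
  qed
  \<comment> \<open>\<open>a n i\<close> is the defect from halving the full cell \<open>i\<close>;
    the rest, \<open>r n t\<close>, comes from the incomplete cell and is zero or one further
    defect.\<close>
  define a where "a = (\<lambda>n i. \<Xi> (g (Suc n) (2*i)) (g (Suc n) (Suc (2*i))) +
     \<Xi> (g (Suc n) (Suc (2*i))) (g (Suc n) (Suc (Suc (2*i)))) - \<Xi> (g n i) (g n (Suc i)))"
  define r where "r = (\<lambda>n t. F (Suc n) t - F n t - (\<Sum>i<k n t. a n i))"
  have sum_double: "(\<Sum>i<2*m. f i) = (\<Sum>i<m. f (2*i) + f (Suc (2*i)))" for f :: "nat \<Rightarrow> real" and m
    by (induction m) simp_all
  have a_bound: "\<bar>a n i\<bar> \<le> K * q^n" if "g n (Suc i) \<le> 1" for n i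
  proof -
    have "g n i \<le> g (Suc n) (Suc (2*i))"
      unfolding gdouble[of n i, symmetric] gle by simp
    moreover have "g (Suc n) (Suc (2*i)) \<le> g n (Suc i)"
      unfolding gdouble'[of n i, symmetric] gle by simp
    ultimately show ?thesis
      unfolding a_def gdouble gdouble'
      using that gap[of n i] by (intro defect' g0) linarith+
  qed
  have r_bound: "\<bar>r n t\<bar> \<le> K * q^n" if t: "0 \<le> t" "t \<le> 1" for n t
    using kdouble[OF t(1), of n]
  proof
    assume *: "k (Suc n) t = 2 * k n t"
    have "r n t = 0"
      unfolding r_def F * sum_double a_def sum_subtractf gdouble gdouble' by simp
    then show ?thesis using K0 q0 by simp
  next
    assume *: "k (Suc n) t = Suc (2 * k n t)"
    let ?u = "g (Suc n) (Suc (2 * k n t))"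
    have "r n t = \<Xi> (g n (k n t)) ?u + \<Xi> ?u t - \<Xi> (g n (k n t)) t"
      unfolding r_def F * sum.lessThan_Suc sum_double a_def sum_subtractf gdouble gdouble' by simp
    moreover have "g n (k n t) \<le> ?u"
      unfolding gdouble[of n "k n t", symmetric] gle by simp
    moreover have "?u \<le> t" using kb(1)[OF t(1), of "Suc n"] * by simp
    moreover have "t - g n (k n t) \<le> 1 / 2^n" using kb(2)[OF t(1), of n] gap[of n "k n t"] by linarith
    ultimately show ?thesis using defect'[of "g n (k n t)" ?u t n] g0 t by simp
  qed
  have kmono: "k n s \<le> k n t" if "s \<le> t" for n s t
    unfolding k_def using that by (intro nat_mono floor_mono) simp
  \<comment> \<open>At most \<open>2^n * (t - s) + 1\<close> full cells contribute, and the
    incomplete cells at \<open>s\<close> and at \<open>t\<close> one defect each; this is the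
    \<open>+ 3\<close>.\<close>
  have step: "\<bar>(F (Suc n) t - F n t) - (F (Suc n) s - F n s)\<bar> \<le> (2^n * (t - s) + 3) * (K * q^n)"
    if st: "0 \<le> s" "s \<le> t" "t \<le> 1" for n s t
  proof -
    have "(F (Suc n) t - F n t) - (F (Suc n) s - F n s) =
      (\<Sum>i<k n t. a n i) - (\<Sum>i<k n s. a n i) + r n t - r n s"
      unfolding r_def by simp
    also have "(\<Sum>i<k n t. a n i) - (\<Sum>i<k n s. a n i) = (\<Sum>i\<in>{k n s..<k n t}. a n i)"
      using sum_diff[of "{..<k n t}" "{..<k n s}" "a n"] kmono[OF st(2)]
      by (simp add: lessThan_minus_lessThan)
    also have "\<bar>(\<Sum>i\<in>{k n s..<k n t}. a n i) + r n t - r n s\<bar> \<le>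
        \<bar>\<Sum>i\<in>{k n s..<k n t}. a n i\<bar> + \<bar>r n t\<bar> + \<bar>r n s\<bar>" by linarith
    also have "\<bar>\<Sum>i\<in>{k n s..<k n t}. a n i\<bar> \<le> (\<Sum>i\<in>{k n s..<k n t}. K * q^n)"
    proof (rule sum_abs[THEN order_trans], rule sum_mono)
      fix i assume "i \<in> {k n s..<k n t}"
      then have "g n (Suc i) \<le> g n (k n t)" unfolding gle by simp
      also have "\<dots> \<le> 1" using kb(1)[of t n] st by simp
      finally show "\<bar>a n i\<bar> \<le> K * q^n" by (rule a_bound)
    qed
    also have "(\<Sum>i\<in>{k n s..<k n t}. K * q^n) = (real (k n t) - real (k n s)) * (K * q^n)"
      using kmono[OF st(2)] by (simp add: of_nat_diff)
    also have "\<dots> \<le> (2^n * (t - s) + 1) * (K * q^n)"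
    proof (rule mult_right_mono)
      have "real (k n t) \<le> 2^n * t" "2^n * s < real (k n s) + 1"
        using kb(1)[of t n] kb(2)[of s n] st unfolding g_def by (auto simp: field_simps)
      then show "real (k n t) - real (k n s) \<le> 2^n * (t - s) + 1"
        by (simp add: algebra_simps)
    qed (use K0 q0 in simp)
    finally have "\<bar>(F (Suc n) t - F n t) - (F (Suc n) s - F n s)\<bar> \<le>
       (2^n * (t - s) + 1) * (K * q^n) + \<bar>r n t\<bar> + \<bar>r n s\<bar>" by simp
    also have "\<dots> \<le> (2^n * (t - s) + 1) * (K * q^n) + K * q^n + K * q^n"
      using r_bound[of t n] r_bound[of s n] st by simp
    finally show ?thesis by (simp add: algebra_simps)
  qed
  have F_0: "F n 0 = 0" for n
    unfolding F k_def g_def by (simp add: diag)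
  have step': "\<bar>F (Suc n) t - F n t\<bar> \<le> 4 * K * (2 * q)^n" if "0 \<le> t" "t \<le> 1" for n t
  proof -
    have "\<bar>F (Suc n) t - F n t\<bar> \<le> (2^n * t + 3) * (K * q^n)"
      using step[of 0 t n] that F_0 by simp
    also have "\<dots> \<le> (4 * 2^n) * (K * q^n)"
    proof (rule mult_right_mono)
      have "2^n * t \<le> 2^n * (1::real)" using that by (intro mult_left_mono) auto
      moreover have "(1::real) \<le> 2^n" by simp
      ultimately show "2^n * t + 3 \<le> 4 * 2^n" by linarith
    qed (use K0 q0 in simp)
    finally show ?thesis by (simp add: power_mult_distrib algebra_simps)
  qed
  have summable_geo: "summable (\<lambda>n. c * (2 * q)^n)" for c
    using q0 q1 by (intro summable_mult summable_geometric) simp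
  have summ: "summable (\<lambda>n. F (Suc n) t - F n t)" if "0 \<le> t" "t \<le> 1" for t
    using step'[OF that] by (intro summable_comparison_test'[OF summable_geo]) auto
  \<comment> \<open>The limit is \<open>F 0 t + L t\<close>. \<open>F_first\<close> restarts the
    series at level \<open>m\<close>, so that the comparison can begin at the scale of t -
    s.\<close>
  define L where "L = (\<lambda>t. suminf (\<lambda>n. F (Suc n) t - F n t))"
  have F_first: "F 0 t + L t = F m t + suminf (\<lambda>n. F (Suc (n + m)) t - F (n + m) t)"
    if "0 \<le> t" "t \<le> 1" for t m
  proof -
    have "(\<Sum>n<m. F (Suc n) t - F n t) = F m t - F 0 t"
      by (induction m) simp_all
    then show ?thesis
      using suminf_split_initial_segment[OF summ[OF that], of m] unfolding L_def by simp
  qed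
  \<comment> \<open>\<open>2 * K\<close> pays for the comparison at level \<open>n\<close>,
    \<open>4 * K / (1 - 2 * q)\<close> for the geometric tail, and \<open>2 powr \<theta>\<close>
    for replacing \<open>1 / 2^n\<close> by \<open>2 * (t - s)\<close>.\<close>
  define C where "C = (2 * K + 4 * K / (1 - 2 * q)) * 2 powr \<theta>"
  have "\<bar>(F 0 t + L t) - (F 0 s + L s) - \<Xi> s t\<bar> \<le> C * (t - s) powr \<theta>"
    if st: "0 \<le> s" "s \<le> t" "t \<le> 1" for s t
  proof (cases "s = t")
    case True
    then show ?thesis using diag[of s] st by simp
  next
    case False
    obtain n where n: "t - s \<le> 1 / 2^n" "1 / 2^n < 2 * (t - s)"
      using dyadic_scale[of "t - s"] False st by auto
    \<comment> \<open>At this level at most one grid point lies in the half-open interval from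
      \<open>s\<close> (excluded) to \<open>t\<close>, so one or two defects suffice.\<close>
    have coarse: "\<bar>F n t - F n s - \<Xi> s t\<bar> \<le> 2 * (K * q^n)"
    proof -
      have "g n (k n t) < g n (Suc (Suc (k n s)))"
        using kb(1)[of t n] kb(2)[of s n] gap[of n "Suc (k n s)"] n(1) st by simp
      then have "k n t = k n s \<or> k n t = Suc (k n s)"
        unfolding gless using kmono[OF st(2), of n] by linarith
      then show ?thesis
      proof
        assume *: "k n t = k n s"
        let ?g = "g n (k n s)"
        have "F n t - F n s - \<Xi> s t = - (\<Xi> ?g s + \<Xi> s t - \<Xi> ?g t)"
          unfolding F * by simp
        moreover have "\<bar>\<Xi> ?g s + \<Xi> s t - \<Xi> ?g t\<bar> \<le> K * q^n"
          using kb[of s n] kb[of t n] gap[of n "k n s"] st * by (intro defect' g0) auto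
        ultimately show ?thesis by linarith
      next
        assume *: "k n t = Suc (k n s)"
        let ?g = "g n (k n s)" and ?h = "g n (Suc (k n s))"
        have "F n t - F n s - \<Xi> s t = (\<Xi> s ?h + \<Xi> ?h t - \<Xi> s t) - (\<Xi> ?g s + \<Xi> s ?h - \<Xi> ?g ?h)"
          unfolding F * by simp
        moreover have "?h \<le> t" using kb(1)[of t n] st * by simp
        moreover have "\<bar>\<Xi> ?g s + \<Xi> s ?h - \<Xi> ?g ?h\<bar> \<le> K * q^n"
          using kb[of s n] kb[of t n] gap[of n "k n s"] st * by (intro defect' g0) auto
        moreover have "\<bar>\<Xi> s ?h + \<Xi> ?h t - \<Xi> s t\<bar> \<le> K * q^n"
          using kb[of s n] kb[of t n] gap[of n "k n s"] st * n(1) by (intro defect') auto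
        ultimately show ?thesis by linarith
      qed
    qed
    let ?d = "\<lambda>j. (F (Suc (j + n)) t - F (j + n) t) - (F (Suc (j + n)) s - F (j + n) s)"
    have d_bound: "norm (?d j) \<le> 4 * K * q^n * (2 * q)^j" for j
    proof -
      have "norm (?d j) \<le> (2^(j+n) * (t - s) + 3) * (K * q^(j+n))"
        using step[OF st, of "j + n"] by simp
      also have "\<dots> \<le> (4 * 2^j) * (K * q^(j+n))"
      proof (rule mult_right_mono)
        have "2^(j+n) * (t - s) \<le> 2^(j+n) * (1 / 2^n)" using n(1) by (intro mult_left_mono) auto
        also have "\<dots> = 2^j" by (simp add: power_add)
        finally show "2^(j+n) * (t - s) + 3 \<le> 4 * 2^j"
          using one_le_power[of "2::real" j] by linarith
      qed (use K0 q0 in simp)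
      finally show ?thesis by (simp add: power_add power_mult_distrib algebra_simps)
    qed
    have "summable (\<lambda>j. F (Suc (j + n)) u - F (j + n) u)" if "u = s \<or> u = t" for u
      using summ[of u] st that by (intro iffD2[OF summable_iff_shift[of "\<lambda>n. F (Suc n) u - F n u"]]) auto
    then have "(F 0 t + L t) - (F 0 s + L s) - \<Xi> s t = (F n t - F n s - \<Xi> s t) + suminf (\<lambda>j. ?d j)"
      using F_first[of t n] F_first[of s n] st
      by (subst suminf_diff[symmetric]) auto
    also have "\<bar>\<dots>\<bar> \<le> 2 * (K * q^n) + suminf (\<lambda>j. 4 * K * q^n * (2 * q)^j)"
      using coarse norm_suminf_le[OF d_bound summable_geo] by simp
    also have "suminf (\<lambda>j. 4 * K * q^n * (2 * q)^j) = 4 * K * q^n * (1 / (1 - 2 * q))"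
      using q0 q1 by (subst suminf_mult) (auto intro: summable_geometric simp: suminf_geometric)
    also have "2 * (K * q^n) + 4 * K * q^n * (1 / (1 - 2 * q)) = (2 * K + 4 * K / (1 - 2 * q)) * q^n"
      by (simp add: algebra_simps)
    also have "\<dots> \<le> (2 * K + 4 * K / (1 - 2 * q)) * (2 * (t - s)) powr \<theta>"
      using n(2) \<theta> K0 q1 st unfolding scale[symmetric]
      by (intro mult_left_mono powr_mono2 add_nonneg_nonneg divide_nonneg_nonneg) auto
    also have "\<dots> = C * (t - s) powr \<theta>"
      unfolding C_def using st by (subst powr_mult) auto
    finally show ?thesis .
  qed
  then show ?thesis using that[of "\<lambda>t. F 0 t + L t" C] by blast
qed

section \<open>Young integration along a control\<close>

text \<open>The Landau symbol O((\<Delta>\<phi>)^\<beta>), uniform over the subintervals of [a,b].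
  As \<open>R\<close> takes two points, increments, remainders and products are all covered.\<close>

definition control_bound ::
    "(real \<Rightarrow> real) \<Rightarrow> real \<Rightarrow> real \<Rightarrow> real \<Rightarrow> (real \<Rightarrow> real \<Rightarrow> real) \<Rightarrow> bool" where
  "control_bound \<phi> \<beta> a b R \<longleftrightarrow>
     (\<exists>C. \<forall>s t. a \<le> s \<longrightarrow> s \<le> t \<longrightarrow> t \<le> b \<longrightarrow> \<bar>R s t\<bar> \<le> C * (\<phi> t - \<phi> s) powr \<beta>)"

lemma control_boundI:
  assumes "\<And>s t. a \<le> s \<Longrightarrow> s \<le> t \<Longrightarrow> t \<le> b \<Longrightarrow> \<bar>R s t\<bar> \<le> C * (\<phi> t - \<phi> s) powr \<beta>"
  shows "control_bound \<phi> \<beta> a b R"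
  using assms unfolding control_bound_def by blast

lemma control_boundE:
  assumes "control_bound \<phi> \<beta> a b R"
  obtains C where "C \<ge> 0"
    "\<And>s t. a \<le> s \<Longrightarrow> s \<le> t \<Longrightarrow> t \<le> b \<Longrightarrow> \<bar>R s t\<bar> \<le> C * (\<phi> t - \<phi> s) powr \<beta>"
proof -
  obtain C where C: "\<And>s t. a \<le> s \<Longrightarrow> s \<le> t \<Longrightarrow> t \<le> b \<Longrightarrow> \<bar>R s t\<bar> \<le> C * (\<phi> t - \<phi> s) powr \<beta>"
    using assms unfolding control_bound_def by blast
  have "\<bar>R s t\<bar> \<le> \<bar>C\<bar> * (\<phi> t - \<phi> s) powr \<beta>" if "a \<le> s" "s \<le> t" "t \<le> b" for s t
    using C[OF that] mult_right_mono[OF abs_ge_self[of C] powr_ge_zero[of "\<phi> t - \<phi> s" \<beta>]]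
    by linarith
  then show ?thesis using that[of "\<bar>C\<bar>"] by simp
qed

lemma control_bound_subst:
  assumes "control_bound \<phi> \<beta> a b R"
    and "\<And>s t. a \<le> s \<Longrightarrow> s \<le> t \<Longrightarrow> t \<le> b \<Longrightarrow> R' s t = R s t"
  shows "control_bound \<phi> \<beta> a b R'"
  using assms unfolding control_bound_def by metis

lemma control_bound_zero: "control_bound \<phi> \<beta> a b (\<lambda>s t. 0)"
  by (rule control_boundI[where C = 0]) simp

lemma control_bound_add:
  assumes "control_bound \<phi> \<beta> a b R" "control_bound \<phi> \<beta> a b S"
  shows "control_bound \<phi> \<beta> a b (\<lambda>s t. R s t + S s t)"
proof -
  obtain C where C: "\<And>s t. a \<le> s \<Longrightarrow> s \<le> t \<Longrightarrow> t \<le> b \<Longrightarrow> \<bar>R s t\<bar> \<le> C * (\<phi> t - \<phi> s) powr \<beta>"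
    using assms(1) by (rule control_boundE) blast
  obtain D where D: "\<And>s t. a \<le> s \<Longrightarrow> s \<le> t \<Longrightarrow> t \<le> b \<Longrightarrow> \<bar>S s t\<bar> \<le> D * (\<phi> t - \<phi> s) powr \<beta>"
    using assms(2) by (rule control_boundE) blast
  show ?thesis
  proof (rule control_boundI[where C = "C + D"])
    fix s t assume st: "a \<le> s" "s \<le> t" "t \<le> b"
    show "\<bar>R s t + S s t\<bar> \<le> (C + D) * (\<phi> t - \<phi> s) powr \<beta>"
      using C[OF st] D[OF st] by (simp add: distrib_right)
  qed
qed

lemma control_bound_bounded_mult:
  assumes "control_bound \<phi> \<beta> a b R"
    and h: "\<And>s t. a \<le> s \<Longrightarrow> s \<le> t \<Longrightarrow> t \<le> b \<Longrightarrow> \<bar>h s t\<bar> \<le> B"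
  shows "control_bound \<phi> \<beta> a b (\<lambda>s t. h s t * R s t)"
proof -
  obtain C where C: "C \<ge> 0"
    "\<And>s t. a \<le> s \<Longrightarrow> s \<le> t \<Longrightarrow> t \<le> b \<Longrightarrow> \<bar>R s t\<bar> \<le> C * (\<phi> t - \<phi> s) powr \<beta>"
    using assms(1) by (rule control_boundE) blast
  show ?thesis
  proof (rule control_boundI[where C = "B * C"])
    fix s t assume st: "a \<le> s" "s \<le> t" "t \<le> b"
    have "\<bar>h s t\<bar> * \<bar>R s t\<bar> \<le> B * (C * (\<phi> t - \<phi> s) powr \<beta>)"
      using h[OF st] C(2)[OF st] by (intro mult_mono) auto
    then show "\<bar>h s t * R s t\<bar> \<le> (B * C) * (\<phi> t - \<phi> s) powr \<beta>"
      by (simp add: abs_mult mult.assoc)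
  qed
qed

lemma control_bound_cmult:
  assumes "control_bound \<phi> \<beta> a b R"
  shows "control_bound \<phi> \<beta> a b (\<lambda>s t. c * R s t)"
  by (rule control_bound_bounded_mult[OF assms, where B = "\<bar>c\<bar>"]) simp

lemma control_bound_diff:
  assumes "control_bound \<phi> \<beta> a b R" "control_bound \<phi> \<beta> a b S"
  shows "control_bound \<phi> \<beta> a b (\<lambda>s t. R s t - S s t)"
  using control_bound_add[OF assms(1) control_bound_cmult[OF assms(2), of "-1"]] by simp

lemma control_bound_sum:
  assumes "\<And>i. i \<in> I \<Longrightarrow> control_bound \<phi> \<beta> a b (R i)"
  shows "control_bound \<phi> \<beta> a b (\<lambda>s t. \<Sum>i\<in>I. R i s t)"
  using assms
  by (induction I rule: infinite_finite_induct)
     (auto intro: control_bound_zero control_bound_add)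

lemma control_bound_sum_list:
  assumes "\<And>w. w \<in> set ws \<Longrightarrow> control_bound \<phi> \<beta> a b (R w)"
  shows "control_bound \<phi> \<beta> a b (\<lambda>s t. \<Sum>w\<leftarrow>ws. R w s t)"
  using assms
  by (induction ws) (auto intro: control_bound_zero control_bound_add)

lemma control_bound_mult:
  assumes "control_bound \<phi> \<beta> a b R" "control_bound \<phi> \<gamma> a b S"
  shows "control_bound \<phi> (\<beta> + \<gamma>) a b (\<lambda>s t. R s t * S s t)"
proof -
  obtain C where C: "C \<ge> 0"
    "\<And>s t. a \<le> s \<Longrightarrow> s \<le> t \<Longrightarrow> t \<le> b \<Longrightarrow> \<bar>R s t\<bar> \<le> C * (\<phi> t - \<phi> s) powr \<beta>"
    using assms(1) by (rule control_boundE) blast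
  obtain D where D: "D \<ge> 0"
    "\<And>s t. a \<le> s \<Longrightarrow> s \<le> t \<Longrightarrow> t \<le> b \<Longrightarrow> \<bar>S s t\<bar> \<le> D * (\<phi> t - \<phi> s) powr \<gamma>"
    using assms(2) by (rule control_boundE) blast
  show ?thesis
  proof (rule control_boundI[where C = "C * D"])
    fix s t assume st: "a \<le> s" "s \<le> t" "t \<le> b"
    have "\<bar>R s t\<bar> * \<bar>S s t\<bar> \<le> (C * (\<phi> t - \<phi> s) powr \<beta>) * (D * (\<phi> t - \<phi> s) powr \<gamma>)"
      using C(2)[OF st] D(2)[OF st] C(1) by (intro mult_mono) auto
    then show "\<bar>R s t * S s t\<bar> \<le> (C * D) * (\<phi> t - \<phi> s) powr (\<beta> + \<gamma>)"
      by (simp add: abs_mult powr_add mult_ac)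
  qed
qed

text \<open>The surplus power of \<Delta>\<phi> is bounded by that of the total increment and moves
  into the constant.\<close>

lemma control_bound_weaken:
  assumes R: "control_bound \<phi> \<beta> a b R" and "mono_on {a..b} \<phi>" and "\<gamma> \<le> \<beta>"
  shows "control_bound \<phi> \<gamma> a b R"
proof -
  obtain C where C: "C \<ge> 0"
    "\<And>s t. a \<le> s \<Longrightarrow> s \<le> t \<Longrightarrow> t \<le> b \<Longrightarrow> \<bar>R s t\<bar> \<le> C * (\<phi> t - \<phi> s) powr \<beta>"
    using R by (rule control_boundE) blast
  show ?thesis
  proof (rule control_boundI[where C = "C * (\<phi> b - \<phi> a) powr (\<beta> - \<gamma>)"])
    fix s t assume st: "a \<le> s" "s \<le> t" "t \<le> b"
    have le: "\<phi> a \<le> \<phi> s" "\<phi> s \<le> \<phi> t" "\<phi> t \<le> \<phi> b"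
      using st assms(2) by (auto simp: mono_on_def)
    have "(\<phi> t - \<phi> s) powr \<beta> = (\<phi> t - \<phi> s) powr (\<beta> - \<gamma>) * (\<phi> t - \<phi> s) powr \<gamma>"
      by (simp flip: powr_add)
    also have "\<dots> \<le> (\<phi> b - \<phi> a) powr (\<beta> - \<gamma>) * (\<phi> t - \<phi> s) powr \<gamma>"
      using le assms(3) by (intro mult_right_mono powr_mono2) auto
    finally have "C * (\<phi> t - \<phi> s) powr \<beta> \<le> C * ((\<phi> b - \<phi> a) powr (\<beta> - \<gamma>) * (\<phi> t - \<phi> s) powr \<gamma>)"
      using C(1) by (rule mult_left_mono)
    with C(2)[OF st] show "\<bar>R s t\<bar> \<le> C * (\<phi> b - \<phi> a) powr (\<beta> - \<gamma>) * (\<phi> t - \<phi> s) powr \<gamma>"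
      by (simp add: mult.assoc)
  qed
qed

text \<open>Only intervals across \<open>c\<close> are new; there \<open>R\<close> is the sum of its
  two halves and a defect that must itself be of the right order. Expansions can thus be checked
  separately on the two sides of a junction.\<close>

lemma control_bound_glue:
  assumes R: "control_bound \<phi> \<beta> a c R" "control_bound \<phi> \<beta> c b R"
    and defect: "\<And>s t. a \<le> s \<Longrightarrow> s \<le> c \<Longrightarrow> c \<le> t \<Longrightarrow> t \<le> b \<Longrightarrow>
      \<bar>R s t - R s c - R c t\<bar> \<le> E * (\<phi> t - \<phi> s) powr \<beta>"
    and "mono_on {a..b} \<phi>" "a \<le> c" "c \<le> b" "0 \<le> \<beta>"
  shows "control_bound \<phi> \<beta> a b R"
proof -
  obtain C where C: "C \<ge> 0"
    "\<And>s t. a \<le> s \<Longrightarrow> s \<le> t \<Longrightarrow> t \<le> c \<Longrightarrow> \<bar>R s t\<bar> \<le> C * (\<phi> t - \<phi> s) powr \<beta>"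
    using R(1) by (rule control_boundE) blast
  obtain D where D: "D \<ge> 0"
    "\<And>s t. c \<le> s \<Longrightarrow> s \<le> t \<Longrightarrow> t \<le> b \<Longrightarrow> \<bar>R s t\<bar> \<le> D * (\<phi> t - \<phi> s) powr \<beta>"
    using R(2) by (rule control_boundE) blast
  show ?thesis
  proof (rule control_boundI[where C = "C + D + \<bar>E\<bar>"])
    fix s t assume st: "a \<le> s" "s \<le> t" "t \<le> b"
    let ?x = "(\<phi> t - \<phi> s) powr \<beta>"
    have x: "C * ?x \<ge> 0" "D * ?x \<ge> 0" "\<bar>E\<bar> * ?x \<ge> 0" "E * ?x \<le> \<bar>E\<bar> * ?x"
      using C(1) D(1) by (auto intro: mult_right_mono)
    consider "t \<le> c" | "c \<le> s" | "s \<le> c" "c \<le> t" by linarith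
    then show "\<bar>R s t\<bar> \<le> (C + D + \<bar>E\<bar>) * ?x"
    proof cases
      case 1
      then show ?thesis using C(2)[of s t] st x unfolding distrib_right by linarith
    next
      case 2
      then show ?thesis using D(2)[of s t] st x unfolding distrib_right by linarith
    next
      case 3
      have le: "\<phi> s \<le> \<phi> c" "\<phi> c \<le> \<phi> t"
        using 3 st assms(4,5,6) by (auto simp: mono_on_def)
      have "(\<phi> c - \<phi> s) powr \<beta> \<le> ?x" "(\<phi> t - \<phi> c) powr \<beta> \<le> ?x"
        using le assms(7) by (auto intro!: powr_mono2)
      then have "C * (\<phi> c - \<phi> s) powr \<beta> \<le> C * ?x" "D * (\<phi> t - \<phi> c) powr \<beta> \<le> D * ?x"
        using C(1) D(1) by (auto intro: mult_left_mono)
      then show ?thesis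
        using C(2)[of s c] D(2)[of c t] defect[of s t] 3 st x unfolding distrib_right by linarith
    qed
  qed
qed

text \<open>
  The tag of a Riemann--Stieltjes sum moves the value of \<open>f\<close> by at most \<open>O(\<Delta>\<phi>\<^sup>\<alpha>)\<close>, so
  \<open>control_bound\<close> with exponent \<open>2\<alpha> > 1\<close> on \<open>\<Delta>G - f \<Delta>g\<close> says \<open>dG = f dg\<close>.
\<close>

lemma powr_double: "(x::real) powr (2 * a) = x powr a * x powr a"
  by (metis mult_2 powr_add)

section \<open>Differentials along a control and Riemann-Stieltjes integrals\<close>

locale control =
  fixes a b :: real and \<phi> :: "real \<Rightarrow> real" and \<alpha> :: real
  assumes le: "a \<le> b"
    and strict: "strict_mono_on {a..b} \<phi>"
    and cont: "continuous_on {a..b} \<phi>"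
    and alpha: "1/2 < \<alpha>"
begin

abbreviation holder :: "(real \<Rightarrow> real) \<Rightarrow> bool" where
  "holder f \<equiv> control_bound \<phi> \<alpha> a b (\<lambda>s t. f t - f s)"

abbreviation negligible :: "(real \<Rightarrow> real \<Rightarrow> real) \<Rightarrow> bool" where
  "negligible R \<equiv> control_bound \<phi> (2 * \<alpha>) a b R"

definition differential :: "(real \<Rightarrow> real) \<Rightarrow> (real \<Rightarrow> real) \<Rightarrow> (real \<Rightarrow> real) \<Rightarrow> bool" where
  "differential f g G \<longleftrightarrow> negligible (\<lambda>s t. G t - G s - f s * (g t - g s))"

lemma phi_mono: "mono_on {a..b} \<phi>"
  using strict by (rule strict_mono_on_imp_mono_on)

lemma phi_le: "a \<le> s \<Longrightarrow> s \<le> t \<Longrightarrow> t \<le> b \<Longrightarrow> \<phi> s \<le> \<phi> t"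
  using phi_mono by (auto simp: mono_on_def)

lemma holder_bounded:
  assumes "holder f"
  obtains B where "\<And>t. a \<le> t \<Longrightarrow> t \<le> b \<Longrightarrow> \<bar>f t\<bar> \<le> B"
proof -
  obtain C where C: "C \<ge> 0"
    "\<And>s t. a \<le> s \<Longrightarrow> s \<le> t \<Longrightarrow> t \<le> b \<Longrightarrow> \<bar>f t - f s\<bar> \<le> C * (\<phi> t - \<phi> s) powr \<alpha>"
    using assms by (rule control_boundE) blast
  have "\<bar>f t\<bar> \<le> \<bar>f a\<bar> + C * (\<phi> b - \<phi> a) powr \<alpha>" if t: "a \<le> t" "t \<le> b" for t
  proof -
    have "C * (\<phi> t - \<phi> a) powr \<alpha> \<le> C * (\<phi> b - \<phi> a) powr \<alpha>"
      using C(1) t phi_le[of a t] phi_le[of t b] alpha by (intro mult_left_mono powr_mono2) auto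
    with C(2)[of a t] t show ?thesis by linarith
  qed
  then show ?thesis using that by blast
qed

lemma holder_const: "holder (\<lambda>t. c)"
  using control_bound_zero by simp

lemma negligible_bounded_mult:
  assumes "holder h" "negligible R"
  shows "negligible (\<lambda>s t. h s * R s t)"
proof -
  obtain B where B: "\<And>t. a \<le> t \<Longrightarrow> t \<le> b \<Longrightarrow> \<bar>h t\<bar> \<le> B" using assms(1) by (rule holder_bounded) blast
  show ?thesis
    by (rule control_bound_bounded_mult[OF assms(2), where h = "\<lambda>s t. h s" and B = B]) (auto intro: B)
qed

text \<open>f dg is O((\<Delta>\<phi>)^\<alpha>) because \<open>f\<close> is bounded, and the
  remainder has higher order. Hence an integral can be the integrand of the next one.\<close>

lemma holder_differential:
  assumes f: "holder f" and g: "holder g" and G: "differential f g G"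
  shows "holder G"
proof -
  obtain B where B: "\<And>t. a \<le> t \<Longrightarrow> t \<le> b \<Longrightarrow> \<bar>f t\<bar> \<le> B" using f by (rule holder_bounded) blast
  have "control_bound \<phi> \<alpha> a b (\<lambda>s t. f s * (g t - g s))"
    by (rule control_bound_bounded_mult[OF g, where h = "\<lambda>s t. f s" and B = B]) (auto intro: B)
  moreover have "control_bound \<phi> \<alpha> a b (\<lambda>s t. G t - G s - f s * (g t - g s))"
    using G phi_mono unfolding differential_def by (rule control_bound_weaken) (use alpha in simp)
  ultimately show ?thesis
    by (rule control_bound_subst[OF control_bound_add]) simp
qed

text \<open>The remainder is exactly the product of the increments of \<open>f\<close> and
  \<open>g\<close>, of order 2 \<alpha>.\<close>

lemma differential_mult:
  assumes "holder f" "holder g"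
  shows "negligible (\<lambda>s t. (f t * g t - f s * g s) - f s * (g t - g s) - g s * (f t - f s))"
  using control_bound_mult[OF assms] unfolding mult_2
  by (rule control_bound_subst) (simp add: algebra_simps)

text \<open>Time is changed by \<phi>, normalised to [0,1], and the germ f dg is sewn with \<theta>
  = 2 \<alpha>: its defect is the product of an increment of \<open>f\<close> and one of
  \<open>g\<close>.\<close>

lemma ex_differential:
  assumes f: "holder f" and g: "holder g"
  obtains G where "differential f g G"
proof (cases "a = b")
  case True
  have "differential f g (\<lambda>_. 0)"
    unfolding differential_def
  proof (rule control_boundI[where C = 0])
    fix s t assume "a \<le> s" "s \<le> t" "t \<le> b"
    then have "s = t" using True by simp
    then show "\<bar>0 - 0 - f s * (g t - g s)\<bar> \<le> 0 * (\<phi> t - \<phi> s) powr (2 * \<alpha>)" by simp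
  qed
  then show ?thesis by (rule that)
next
  case False
  define L where "L = \<phi> b - \<phi> a"
  have \<phi>b: "\<phi> b = \<phi> a + L" unfolding L_def by simp
  have L: "L > 0"
    using False le strict unfolding L_def strict_mono_on_def by force
  \<comment> \<open>The inverse time change: by the intermediate value theorem it is a right inverse
    of the normalised \<phi> on all of [0,1], by strictness also a left inverse.\<close>
  define \<psi> where "\<psi> = (\<lambda>x. inv_into {a..b} \<phi> (\<phi> a + L * x))"
  have img: "\<phi> a + L * x \<in> \<phi> ` {a..b}" if x: "0 \<le> x" "x \<le> 1" for x
  proof -
    have "L * x \<le> L * 1" using x L by (intro mult_left_mono) auto
    then have "\<phi> a \<le> \<phi> a + L * x" "\<phi> a + L * x \<le> \<phi> b" using x L \<phi>b by auto
    then obtain t where "a \<le> t" "t \<le> b" "\<phi> t = \<phi> a + L * x"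
      using IVT'[of \<phi> a "\<phi> a + L * x" b] le cont by auto
    then show ?thesis by (auto intro!: image_eqI[of _ _ t])
  qed
  have \<psi>: "a \<le> \<psi> x" "\<psi> x \<le> b" "\<phi> (\<psi> x) = \<phi> a + L * x" if "0 \<le> x" "x \<le> 1" for x
    using inv_into_into[OF img[OF that]] f_inv_into_f[OF img[OF that]] unfolding \<psi>_def by auto
  have \<psi>_mono: "\<psi> x \<le> \<psi> y" if "0 \<le> x" "x \<le> y" "y \<le> 1" for x y
  proof (rule ccontr)
    assume "\<not> \<psi> x \<le> \<psi> y"
    then have "\<phi> (\<psi> y) < \<phi> (\<psi> x)"
      using strict \<psi>(1,2)[of x] \<psi>(1,2)[of y] that unfolding strict_mono_on_def by auto
    then show False using \<psi>(3)[of x] \<psi>(3)[of y] that L by simp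
  qed
  obtain C where C: "C \<ge> 0"
    "\<And>s t. a \<le> s \<Longrightarrow> s \<le> t \<Longrightarrow> t \<le> b \<Longrightarrow> \<bar>f t - f s\<bar> \<le> C * (\<phi> t - \<phi> s) powr \<alpha>"
    using f by (rule control_boundE) blast
  obtain D where D: "D \<ge> 0"
    "\<And>s t. a \<le> s \<Longrightarrow> s \<le> t \<Longrightarrow> t \<le> b \<Longrightarrow> \<bar>g t - g s\<bar> \<le> D * (\<phi> t - \<phi> s) powr \<alpha>"
    using g by (rule control_boundE) blast
  define \<Xi> where "\<Xi> = (\<lambda>x y. f (\<psi> x) * (g (\<psi> y) - g (\<psi> x)))"
  have "\<bar>\<Xi> x u + \<Xi> u y - \<Xi> x y\<bar> \<le> (C * D * L powr (2 * \<alpha>)) * (y - x) powr (2 * \<alpha>)"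
    if xy: "0 \<le> x" "x \<le> u" "u \<le> y" "y \<le> 1" for x u y
  proof -
    have "\<Xi> x u + \<Xi> u y - \<Xi> x y = (f (\<psi> u) - f (\<psi> x)) * (g (\<psi> y) - g (\<psi> u))"
      unfolding \<Xi>_def by (simp add: algebra_simps)
    also have "\<bar>\<dots>\<bar> \<le> (C * (\<phi> (\<psi> u) - \<phi> (\<psi> x)) powr \<alpha>) * (D * (\<phi> (\<psi> y) - \<phi> (\<psi> u)) powr \<alpha>)"
      unfolding abs_mult using C D xy \<psi>_mono[of x u] \<psi>_mono[of u y] \<psi>(1,2)[of x] \<psi>(1,2)[of y]
      by (intro mult_mono) auto
    also have "\<dots> \<le> (C * (L * (y - x)) powr \<alpha>) * (D * (L * (y - x)) powr \<alpha>)"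
      using C(1) D(1) xy L alpha \<psi>(3)[of x] \<psi>(3)[of u] \<psi>(3)[of y]
      by (intro mult_mono mult_left_mono powr_mono2) (auto simp flip: right_diff_distrib)
    also have "\<dots> = (C * D * L powr (2 * \<alpha>)) * (y - x) powr (2 * \<alpha>)"
      using L xy by (simp add: powr_mult powr_double)
    finally show ?thesis .
  qed
  moreover have "2 * \<alpha> > 1" using alpha by simp
  ultimately obtain F E where F: "\<And>s t. 0 \<le> s \<Longrightarrow> s \<le> t \<Longrightarrow> t \<le> 1 \<Longrightarrow>
      \<bar>F t - F s - \<Xi> s t\<bar> \<le> E * (t - s) powr (2 * \<alpha>)"
    using sewing by blast
  define x where "x = (\<lambda>t. (\<phi> t - \<phi> a) / L)"
  have \<psi>x: "\<psi> (x t) = t" if "a \<le> t" "t \<le> b" for t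
    unfolding \<psi>_def x_def using L that inv_into_f_f[OF strict_mono_on_imp_inj_on[OF strict], of t] by simp
  have "differential f g (\<lambda>t. F (x t))"
    unfolding differential_def
  proof (rule control_boundI[where C = "E * (1 / L) powr (2 * \<alpha>)"])
    fix s t assume st: "a \<le> s" "s \<le> t" "t \<le> b"
    have "0 \<le> x s" "x s \<le> x t" "x t \<le> 1"
      using phi_le[of a s] phi_le[of s t] phi_le[of t b] st L
      unfolding x_def by (auto simp: divide_simps L_def)
    from F[OF this] have "\<bar>F (x t) - F (x s) - f s * (g t - g s)\<bar> \<le> E * (x t - x s) powr (2 * \<alpha>)"
      using \<psi>x[of s] \<psi>x[of t] st unfolding \<Xi>_def by simp
    also have "x t - x s = (1 / L) * (\<phi> t - \<phi> s)"
      unfolding x_def by (simp add: diff_divide_distrib)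
    also have "\<dots> powr (2 * \<alpha>) = (1 / L) powr (2 * \<alpha>) * (\<phi> t - \<phi> s) powr (2 * \<alpha>)"
      by (rule powr_mult)
    finally show "\<bar>F (x t) - F (x s) - f s * (g t - g s)\<bar>
        \<le> E * (1 / L) powr (2 * \<alpha>) * (\<phi> t - \<phi> s) powr (2 * \<alpha>)"
      by (simp add: mult.assoc)
  qed
  then show ?thesis by (rule that)
qed

text \<open>A summand differs from the increment of \<open>G\<close> on its cell by
  O((\<Delta>\<phi>)^(2 \<alpha>)). One factor \<Delta>\<phi> telescopes; the remaining power 2
  \<alpha> - 1 > 0 is uniformly small by uniform continuity of \<phi>.\<close>

lemma has_rs_integral_differential:
  assumes f: "holder f" and g: "holder g" and G: "differential f g G" and c: "a \<le> c" "c \<le> b"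
  shows "has_rs_integral f g a c (G c - G a)"
  unfolding has_rs_integral_def
proof (intro allI impI)
  fix e :: real assume e: "e > 0"
  obtain C where C: "C \<ge> 0"
    "\<And>s t. a \<le> s \<Longrightarrow> s \<le> t \<Longrightarrow> t \<le> b \<Longrightarrow> \<bar>f t - f s\<bar> \<le> C * (\<phi> t - \<phi> s) powr \<alpha>"
    using f by (rule control_boundE) blast
  obtain D where D: "D \<ge> 0"
    "\<And>s t. a \<le> s \<Longrightarrow> s \<le> t \<Longrightarrow> t \<le> b \<Longrightarrow> \<bar>g t - g s\<bar> \<le> D * (\<phi> t - \<phi> s) powr \<alpha>"
    using g by (rule control_boundE) blast
  obtain E where E: "E \<ge> 0"
    "\<And>s t. a \<le> s \<Longrightarrow> s \<le> t \<Longrightarrow> t \<le> b \<Longrightarrow>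
      \<bar>G t - G s - f s * (g t - g s)\<bar> \<le> E * (\<phi> t - \<phi> s) powr (2 * \<alpha>)"
    using G unfolding differential_def by (rule control_boundE) blast
  \<comment> \<open>The summand 1 keeps \<open>M\<close> positive even if the constants vanish;
    below, \<eta> bounds \<Delta>\<phi> on a cell so that the total error stays under
    \<open>e / 2\<close>.\<close>
  define M where "M = (C * D + E) * (\<phi> b - \<phi> a) + 1"
  have M: "M > 0"
    unfolding M_def using C(1) D(1) E(1) phi_le[of a b] le by (intro add_nonneg_pos mult_nonneg_nonneg) auto
  have term_bound: "\<bar>f x * (g t - g s) - (G t - G s)\<bar> \<le> (C * D + E) * (\<phi> t - \<phi> s) powr (2 * \<alpha>)"
    if "a \<le> s" "s \<le> x" "x \<le> t" "t \<le> b" for s x t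
  proof -
    have "\<bar>(f x - f s) * (g t - g s)\<bar> \<le> (C * (\<phi> x - \<phi> s) powr \<alpha>) * (D * (\<phi> t - \<phi> s) powr \<alpha>)"
      unfolding abs_mult using C D that by (intro mult_mono) auto
    also have "\<dots> \<le> (C * (\<phi> t - \<phi> s) powr \<alpha>) * (D * (\<phi> t - \<phi> s) powr \<alpha>)"
      using C(1) D(1) alpha that phi_le[of s x] phi_le[of x t]
      by (intro mult_right_mono mult_left_mono powr_mono2) auto
    also have "\<dots> = C * D * (\<phi> t - \<phi> s) powr (2 * \<alpha>)" by (simp add: powr_double)
    finally have "\<bar>(f x - f s) * (g t - g s)\<bar> \<le> C * D * (\<phi> t - \<phi> s) powr (2 * \<alpha>)" .
    moreover have "f x * (g t - g s) - (G t - G s) =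
        (f x - f s) * (g t - g s) - (G t - G s - f s * (g t - g s))" by (simp add: algebra_simps)
    ultimately show ?thesis using E(2)[of s t] that unfolding distrib_right by linarith
  qed
  define \<eta> where "\<eta> = (e / (2 * M)) powr (1 / (2 * \<alpha> - 1))"
  have \<eta>: "\<eta> > 0" unfolding \<eta>_def using e M by simp
  have \<eta>': "\<eta> powr (2 * \<alpha> - 1) = e / (2 * M)"
    unfolding \<eta>_def using e M alpha by (simp add: powr_powr)
  have "uniformly_continuous_on {a..b} \<phi>" using cont by (intro compact_uniformly_continuous) auto
  then have "\<exists>\<delta>>0. \<forall>s\<in>{a..b}. \<forall>t\<in>{a..b}. \<bar>t - s\<bar> < \<delta> \<longrightarrow> \<bar>\<phi> t - \<phi> s\<bar> < \<eta>"
    using \<eta> unfolding uniformly_continuous_on_def dist_real_def by simp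
  then obtain \<delta> where \<delta>: "\<delta> > 0"
    "\<And>s t. s \<in> {a..b} \<Longrightarrow> t \<in> {a..b} \<Longrightarrow> \<bar>t - s\<bar> < \<delta> \<Longrightarrow> \<bar>\<phi> t - \<phi> s\<bar> < \<eta>"
    by blast
  show "\<exists>\<delta>>0. \<forall>P. P tagged_division_of {a..c} \<and> (\<forall>(x, K)\<in>P. Sup K - Inf K < \<delta>) \<longrightarrow>
        \<bar>(\<Sum>(x, K)\<in>P. f x * (g (Sup K) - g (Inf K))) - (G c - G a)\<bar> < e"
  proof (intro exI[of _ \<delta>] conjI allI impI)
    fix P assume P: "P tagged_division_of {a..c} \<and> (\<forall>(x, K)\<in>P. Sup K - Inf K < \<delta>)"
    have cell: "\<bar>f x * (g (Sup K) - g (Inf K)) - (G (Sup K) - G (Inf K))\<bar> \<le>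
        (C * D + E) * (e / (2 * M)) * (\<phi> (Sup K) - \<phi> (Inf K))" if xK: "(x, K) \<in> P" for x K
    proof -
      obtain s t where K: "K = {s..t}" "x \<in> K" "K \<subseteq> {a..c}"
        using tagged_division_ofD(2-4)[OF conjunct1[OF P] xK] by auto
      then have st: "a \<le> s" "s \<le> x" "x \<le> t" "t \<le> b" "s \<le> t" using c by auto
      have SI: "Sup K = t" "Inf K = s" using K st by auto
      have "t - s < \<delta>" using P xK SI by auto
      then have "\<phi> t - \<phi> s < \<eta>" using \<delta>(2)[of s t] st by auto
      then have "(\<phi> t - \<phi> s) powr (2 * \<alpha> - 1) \<le> e / (2 * M)"
        unfolding \<eta>'[symmetric] using phi_le[of s t] st alpha by (intro powr_mono2) auto
      moreover have "(\<phi> t - \<phi> s) powr (2 * \<alpha>) = (\<phi> t - \<phi> s) powr (2 * \<alpha> - 1) * (\<phi> t - \<phi> s)"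
        using powr_add[of "\<phi> t - \<phi> s" "2 * \<alpha> - 1" 1] phi_le[of s t] st by simp
      ultimately have "(\<phi> t - \<phi> s) powr (2 * \<alpha>) \<le> e / (2 * M) * (\<phi> t - \<phi> s)"
        using phi_le[of s t] st by (simp only: mult_right_mono diff_ge_0_iff_ge)
      then have "(C * D + E) * (\<phi> t - \<phi> s) powr (2 * \<alpha>) \<le> (C * D + E) * (e / (2 * M) * (\<phi> t - \<phi> s))"
        using C(1) D(1) E(1) by (intro mult_left_mono) auto
      with term_bound[of s x t] st SI show ?thesis by (simp add: mult.assoc)
    qed
    have "(\<Sum>(x, K)\<in>P. f x * (g (Sup K) - g (Inf K))) - (G c - G a) =
        (\<Sum>(x, K)\<in>P. f x * (g (Sup K) - g (Inf K)) - (G (Sup K) - G (Inf K)))"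
      using additive_tagged_division_1[OF c(1) conjunct1[OF P], of G]
      by (simp add: case_prod_unfold sum_subtractf)
    also have "\<bar>\<dots>\<bar> \<le> (\<Sum>(x, K)\<in>P. (C * D + E) * (e / (2 * M)) * (\<phi> (Sup K) - \<phi> (Inf K)))"
      by (rule sum_abs[THEN order_trans], rule sum_mono) (use cell in auto)
    also have "\<dots> = (C * D + E) * (e / (2 * M)) * (\<phi> c - \<phi> a)"
      using additive_tagged_division_1[OF c(1) conjunct1[OF P], of \<phi>]
      by (simp only: case_prod_unfold flip: sum_distrib_left)
    also have "\<dots> \<le> (C * D + E) * (e / (2 * M)) * (\<phi> b - \<phi> a)"
      using C(1) D(1) E(1) e M phi_le[of c b] c by (intro mult_left_mono) auto
    also have "\<dots> = (M - 1) * (e / (2 * M))" unfolding M_def by (simp add: algebra_simps)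
    also have "\<dots> = e / 2 - e / (2 * M)" using M by (simp add: field_simps)
    also have "\<dots> < e" using M e by (smt (verit) divide_pos_pos field_sum_of_halves)
    finally show "\<bar>(\<Sum>(x, K)\<in>P. f x * (g (Sup K) - g (Inf K))) - (G c - G a)\<bar> < e" .
  qed (rule \<delta>(1))
qed

end

text \<open>Tagged divisions of arbitrarily small mesh exist by Cousin's lemma, applied to a gauge
  of balls; otherwise the limit condition could hold vacuously for every value.\<close>

lemma has_rs_integral_unique:
  assumes "has_rs_integral f g a b I" "has_rs_integral f g a b J"
  shows "I = J"
proof (rule ccontr)
  assume "I \<noteq> J"
  define e where "e = \<bar>I - J\<bar> / 2"
  have e: "e > 0" unfolding e_def using \<open>I \<noteq> J\<close> by simp
  let ?S = "\<lambda>P. \<Sum>(x, K)\<in>P. f x * (g (Sup K) - g (Inf K))"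
  obtain \<delta> where \<delta>: "\<delta> > 0"
    "\<forall>P. P tagged_division_of {a..b} \<and> (\<forall>(x, K)\<in>P. Sup K - Inf K < \<delta>) \<longrightarrow> \<bar>?S P - I\<bar> < e"
    using assms(1)[unfolded has_rs_integral_def, rule_format, OF e] by blast
  obtain \<epsilon> where \<epsilon>: "\<epsilon> > 0"
    "\<forall>P. P tagged_division_of {a..b} \<and> (\<forall>(x, K)\<in>P. Sup K - Inf K < \<epsilon>) \<longrightarrow> \<bar>?S P - J\<bar> < e"
    using assms(2)[unfolded has_rs_integral_def, rule_format, OF e] by blast
  let ?r = "min \<delta> \<epsilon> / 2"
  have "gauge (\<lambda>x. ball x ?r)" using \<delta>(1) \<epsilon>(1) by (intro gauge_ball) auto
  then obtain P where P: "P tagged_division_of {a..b}" "(\<lambda>x. ball x ?r) fine P"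
    by (rule fine_division_exists_real)
  have "Sup K - Inf K < min \<delta> \<epsilon>" if xK: "(x, K) \<in> P" for x K
  proof -
    obtain s t where K: "K = {s..t}" "x \<in> K"
      using tagged_division_ofD(2,4)[OF P(1) xK] by auto
    have "K \<subseteq> ball x ?r" by (rule fineD[OF P(2) xK])
    moreover have "s \<in> K" "t \<in> K" using K by auto
    ultimately have "s \<in> ball x ?r" "t \<in> ball x ?r" by (metis subsetD)+
    then show ?thesis using K by (auto simp: dist_real_def)
  qed
  then have "\<forall>(x, K)\<in>P. Sup K - Inf K < \<delta>" "\<forall>(x, K)\<in>P. Sup K - Inf K < \<epsilon>"
    by fastforce+
  then have "\<bar>?S P - I\<bar> < e" "\<bar>?S P - J\<bar> < e"
    using \<delta>(2) \<epsilon>(2) P(1) by blast+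
  moreover have False if "\<bar>x - I\<bar> < e" "\<bar>x - J\<bar> < e" for x
    using that unfolding e_def by (auto simp: abs_if field_simps split: if_splits)
  ultimately show False by blast
qed

context control
begin

lemma rs_integral_differential:
  assumes "holder f" "holder g" "differential f g G" "a \<le> c" "c \<le> b"
  shows "rs_integral f g a c = G c - G a"
  unfolding rs_integral_def
  using has_rs_integral_differential[OF assms] by (blast intro: the_equality has_rs_integral_unique)

lemma differential_rs_integral:
  assumes f: "holder f" and g: "holder g"
  shows "differential f g (rs_integral f g a)"
proof -
  obtain G where G: "differential f g G" using f g by (rule ex_differential)
  show ?thesis
    using G unfolding differential_def
    by (rule control_bound_subst) (simp add: rs_integral_differential[OF f g G])
qed

lemma rs_integral_start:
  assumes f: "holder f" and g: "holder g"
  shows "rs_integral f g a a = 0"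
proof -
  obtain G where G: "differential f g G" using f g by (rule ex_differential)
  show ?thesis using rs_integral_differential[OF f g G] le by simp
qed

text \<open>Both \<open>h\<close> and the constant 0 are indefinite integrals of 0 against 0, so
  uniqueness of the integral equates their increments.\<close>

lemma negligible_increment_eq:
  assumes "negligible (\<lambda>s t. h t - h s)" "a \<le> t" "t \<le> b"
  shows "h t = h a"
proof -
  have "differential (\<lambda>_. 0) (\<lambda>_. 0) h" "differential (\<lambda>_. 0) (\<lambda>_. 0) (\<lambda>_. 0)"
    using assms(1) control_bound_zero unfolding differential_def by simp_all
  then have "h t - h a = 0 - (0::real)"
    using rs_integral_differential[OF holder_const holder_const _ assms(2,3)] by metis
  then show ?thesis by simp
qed

end

section \<open>Iterated integrals\<close>

text \<open>One \<phi> and one \<alpha> serve every coordinate \<open>i\<close>. For a path in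
  \<open>paths d\<close> the coordinates from \<open>d\<close> on vanish, so the dimension does not
  enter the locale.\<close>

locale path_control = control 0 "end_time X" \<phi> \<alpha> for X :: path and \<phi> \<alpha> +
  assumes holder_path: "holder (\<lambda>t. path_at X t i)"
begin

lemma end_time_nonneg: "0 \<le> end_time X"
  by (rule le)

lemma iterated_integral_0: "iterated_integral X w 0 = (if w = [] then 1 else 0)"
  and holder_iterated_integral: "holder (iterated_integral X w)"
proof -
  have holder: "holder (iterated_integral X w)" for w
  proof (induction w)
    case Nil
    then show ?case using holder_const[of 1] by simp
  next
    case (Cons i w)
    show ?case
      using holder_differential[OF Cons.IH holder_path differential_rs_integral[OF Cons.IH holder_path]]
      by simp
  qed
  then show "holder (iterated_integral X w)" .
  show "iterated_integral X w 0 = (if w = [] then 1 else 0)"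
    using rs_integral_start[OF holder holder_path] by (cases w) auto
qed

lemma differential_iterated_integral:
  "differential (iterated_integral X w) (\<lambda>t. path_at X t i) (iterated_integral X (i # w))"
  using differential_rs_integral[OF holder_iterated_integral holder_path]
  by (simp add: differential_def)

end

text \<open>A list and not a set, because the shuffle product counts words with multiplicity. Words
  are reversed, so the head that the recursion splits off is the outermost integration
  variable.\<close>

fun shuffle_words :: "'a list \<Rightarrow> 'a list \<Rightarrow> 'a list list" where
  "shuffle_words [] v = [v]"
| "shuffle_words (i # u) [] = [i # u]"
| "shuffle_words (i # u) (j # v) =
     map ((#) i) (shuffle_words u (j # v)) @ map ((#) j) (shuffle_words (i # u) v)"

lemma set_shuffle_words: "w \<in> set (shuffle_words u v) \<Longrightarrow> set w = set u \<union> set v"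
  by (induction u v arbitrary: w rule: shuffle_words.induct) fastforce+

text \<open>Let \<open>h\<close> be the difference of the two sides. To first order dh is a
  combination of dX_i and dX_j, and the two induction hypotheses make both coefficients vanish. So
  \<open>h\<close> is constant, and it is 0 at time 0.\<close>

lemma (in path_control) iterated_integral_shuffle:
  assumes "0 \<le> t" "t \<le> end_time X"
  shows "iterated_integral X u t * iterated_integral X v t =
    (\<Sum>w\<leftarrow>shuffle_words u v. iterated_integral X w t)"
  using assms
proof (induction u v arbitrary: t rule: shuffle_words.induct)
  case (3 i u j v)
  let ?I = "iterated_integral X" and ?X = "\<lambda>i t. path_at X t i"
  let ?P = "?I (i # u)" and ?Q = "?I (j # v)"
  let ?A = "shuffle_words u (j # v)" and ?B = "shuffle_words (i # u) v"
  define h where "h = (\<lambda>t. ?P t * ?Q t - (\<Sum>w\<leftarrow>shuffle_words (i # u) (j # v). ?I w t))"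
  have diff: "negligible (\<lambda>s t. ?I (k # w) t - ?I (k # w) s - ?I w s * (?X k t - ?X k s))" for k w
    using differential_iterated_integral unfolding differential_def .
  have prod: "negligible (\<lambda>s t. (?P t * ?Q t - ?P s * ?Q s) - ?P s * (?Q t - ?Q s) - ?Q s * (?P t - ?P s))"
    by (rule differential_mult) (rule holder_iterated_integral)+
  have "negligible (\<lambda>s t. h t - h s)"
  proof (rule control_bound_subst)
    \<comment> \<open>The product-rule remainder, then the remainders of dQ and dP weighted by the
      other factor, minus the remainders of all shuffled words.\<close>
    show "negligible (\<lambda>s t. ((((?P t * ?Q t - ?P s * ?Q s) - ?P s * (?Q t - ?Q s) - ?Q s * (?P t - ?P s)) +
        ?P s * (?Q t - ?Q s - ?I v s * (?X j t - ?X j s)) +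
        ?Q s * (?P t - ?P s - ?I u s * (?X i t - ?X i s))) -
        (\<Sum>w\<leftarrow>?A. ?I (i # w) t - ?I (i # w) s - ?I w s * (?X i t - ?X i s))) -
        (\<Sum>w\<leftarrow>?B. ?I (j # w) t - ?I (j # w) s - ?I w s * (?X j t - ?X j s)))"
      by (intro control_bound_diff control_bound_add control_bound_sum_list prod diff
          negligible_bounded_mult holder_iterated_integral)
    fix s t assume st: "0 \<le> s" "s \<le> t" "t \<le> end_time X"
    have IH: "(\<Sum>w\<leftarrow>?A. ?I w s) = ?I u s * ?Q s" "(\<Sum>w\<leftarrow>?B. ?I w s) = ?P s * ?I v s"
      using "3.IH"[of s] st by simp_all
    have expand: "(\<Sum>w\<leftarrow>ws. ?I (k # w) t - ?I (k # w) s - ?I w s * (?X k t - ?X k s)) =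
       (\<Sum>w\<leftarrow>ws. ?I (k # w) t) - (\<Sum>w\<leftarrow>ws. ?I (k # w) s) - (\<Sum>w\<leftarrow>ws. ?I w s) * (?X k t - ?X k s)"
      for ws k
      by (induction ws) (simp_all add: algebra_simps del: iterated_integral.simps)
    show "h t - h s = ((((?P t * ?Q t - ?P s * ?Q s) - ?P s * (?Q t - ?Q s) - ?Q s * (?P t - ?P s)) +
        ?P s * (?Q t - ?Q s - ?I v s * (?X j t - ?X j s)) +
        ?Q s * (?P t - ?P s - ?I u s * (?X i t - ?X i s))) -
        (\<Sum>w\<leftarrow>?A. ?I (i # w) t - ?I (i # w) s - ?I w s * (?X i t - ?X i s))) -
        (\<Sum>w\<leftarrow>?B. ?I (j # w) t - ?I (j # w) s - ?I w s * (?X j t - ?X j s))"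
      unfolding expand IH h_def
      by (simp add: o_def algebra_simps del: iterated_integral.simps)
  qed
  then have "h t = h 0"
    using 3 by (intro negligible_increment_eq) auto
  also have "\<dots> = 0"
    unfolding h_def by (simp add: o_def iterated_integral_0 del: iterated_integral.simps)
  finally show ?case unfolding h_def by simp
qed simp_all

section \<open>Concatenation of controls and Chen's identity\<close>

definition concat_control :: "real \<Rightarrow> (real \<Rightarrow> real) \<Rightarrow> (real \<Rightarrow> real) \<Rightarrow> real \<Rightarrow> real" where
  "concat_control T \<phi> \<psi> t = (if t \<le> T then \<phi> t else \<phi> T - \<psi> 0 + \<psi> (t - T))"

lemma concat_control_left: "t \<le> T \<Longrightarrow> concat_control T \<phi> \<psi> t = \<phi> t"
  and concat_control_right: "T \<le> t \<Longrightarrow> concat_control T \<phi> \<psi> t = \<phi> T - \<psi> 0 + \<psi> (t - T)"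
  unfolding concat_control_def by auto

lemma control_concat:
  assumes "control 0 T \<phi> \<alpha>" "control 0 U \<psi> \<alpha>"
  shows "control 0 (T + U) (concat_control T \<phi> \<psi>) \<alpha>"
proof -
  interpret X: control 0 T \<phi> \<alpha> by fact
  interpret Y: control 0 U \<psi> \<alpha> by fact
  show ?thesis
  proof
    show "0 \<le> T + U" using X.le Y.le by simp
    show "1 / 2 < \<alpha>" by (rule X.alpha)
    show "strict_mono_on {0..T + U} (concat_control T \<phi> \<psi>)"
    proof (rule strict_mono_onI)
      fix s t assume st: "s \<in> {0..T + U}" "t \<in> {0..T + U}" "s < t"
      have \<phi>_less: "\<phi> s < \<phi> t" if "0 \<le> s" "s < t" "t \<le> T" for s t
        using X.strict that by (auto simp: strict_mono_on_def)
      have \<psi>_less: "\<psi> s < \<psi> t" if "0 \<le> s" "s < t" "t \<le> U" for s t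
        using Y.strict that by (auto simp: strict_mono_on_def)
      consider "t \<le> T" | "s \<le> T" "T < t" | "T < s" by linarith
      then show "concat_control T \<phi> \<psi> s < concat_control T \<phi> \<psi> t"
      proof cases
        case 1
        then show ?thesis using st \<phi>_less[of s t] by (auto simp: concat_control_def)
      next
        case 2
        then show ?thesis
          using st X.phi_le[of s T] \<psi>_less[of 0 "t - T"] by (auto simp: concat_control_def)
      next
        case 3
        then show ?thesis using st \<psi>_less[of "s - T" "t - T"] by (auto simp: concat_control_def)
      qed
    qed
    have "continuous_on {0..T + U} (\<lambda>t. if t \<le> T then \<phi> t else \<phi> T - \<psi> 0 + \<psi> (t - T))"
    proof (rule continuous_on_cases_le[where h = "\<lambda>t. t"])
      show "continuous_on {t \<in> {0..T + U}. t \<le> T} \<phi>"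
        using X.cont by (rule continuous_on_subset) auto
      have "continuous_on {t \<in> {0..T + U}. T \<le> t} (\<lambda>t. \<psi> (t - T))"
        by (rule continuous_on_compose2[OF Y.cont]) (auto intro: continuous_intros)
      then show "continuous_on {t \<in> {0..T + U}. T \<le> t} (\<lambda>t. \<phi> T - \<psi> 0 + \<psi> (t - T))"
        by (intro continuous_intros)
    qed (auto intro: continuous_intros)
    then show "continuous_on {0..T + U} (concat_control T \<phi> \<psi>)"
      unfolding concat_control_def .
  qed
qed

text \<open>\<open>control_bound_glue\<close> at the junction, with the second bound given on the
  clock of the second piece and shifted by \<open>T\<close>.\<close>

lemma control_bound_concat:
  assumes "control 0 T \<phi> \<alpha>" "control 0 U \<psi> \<alpha>"
    and R1: "control_bound \<phi> \<beta> 0 T R1" and R2: "control_bound \<psi> \<beta> 0 U R2"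
    and left: "\<And>s t. 0 \<le> s \<Longrightarrow> s \<le> t \<Longrightarrow> t \<le> T \<Longrightarrow> R s t = R1 s t"
    and right: "\<And>s t. T \<le> s \<Longrightarrow> s \<le> t \<Longrightarrow> t \<le> T + U \<Longrightarrow> R s t = R2 (s - T) (t - T)"
    and defect: "\<And>s t. 0 \<le> s \<Longrightarrow> s \<le> T \<Longrightarrow> T \<le> t \<Longrightarrow> t \<le> T + U \<Longrightarrow> \<bar>R s t - R s T - R T t\<bar> \<le>
      E * (concat_control T \<phi> \<psi> t - concat_control T \<phi> \<psi> s) powr \<beta>"
    and "0 \<le> \<beta>"
  shows "control_bound (concat_control T \<phi> \<psi>) \<beta> 0 (T + U) R"
proof -
  interpret X: control 0 T \<phi> \<alpha> by fact
  interpret Y: control 0 U \<psi> \<alpha> by fact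
  interpret Z: control 0 "T + U" "concat_control T \<phi> \<psi>" \<alpha>
    using assms(1,2) by (rule control_concat)
  show ?thesis
  proof (rule control_bound_glue[OF _ _ defect Z.phi_mono])
    obtain C where "\<And>s t. 0 \<le> s \<Longrightarrow> s \<le> t \<Longrightarrow> t \<le> T \<Longrightarrow> \<bar>R1 s t\<bar> \<le> C * (\<phi> t - \<phi> s) powr \<beta>"
      using R1 by (rule control_boundE) blast
    then show "control_bound (concat_control T \<phi> \<psi>) \<beta> 0 T R"
      by (intro control_boundI[where C = C]) (simp add: left concat_control_left)
    obtain D where "\<And>s t. 0 \<le> s \<Longrightarrow> s \<le> t \<Longrightarrow> t \<le> U \<Longrightarrow> \<bar>R2 s t\<bar> \<le> D * (\<psi> t - \<psi> s) powr \<beta>"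
      using R2 by (rule control_boundE) blast
    from this[of "_ - T" "_ - T"]
    show "control_bound (concat_control T \<phi> \<psi>) \<beta> T (T + U) R"
      by (intro control_boundI[where C = D]) (simp add: right concat_control_right)
  qed (use X.le Y.le assms(8) in auto)
qed

lemma end_time_concat [simp]: "end_time (X \<squnion>\<^sub>p Y) = end_time X + end_time Y"
  by (simp add: path_concat_def)

lemma path_at_concat_left:
  "0 \<le> t \<Longrightarrow> t \<le> end_time X \<Longrightarrow> 0 \<le> end_time Y \<Longrightarrow> path_at (X \<squnion>\<^sub>p Y) t = path_at X t"
  by (simp add: path_concat_def)

lemma path_at_concat_right:
  "0 \<le> end_time X \<Longrightarrow> end_time X \<le> t \<Longrightarrow> t \<le> end_time X + end_time Y \<Longrightarrow>
   path_at (X \<squnion>\<^sub>p Y) t i = path_at Y (t - end_time X) i + path_at X (end_time X) i - path_at Y 0 i"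
  by (auto simp: path_concat_def)

lemma path_control_concat:
  assumes "path_control X \<phi> \<alpha>" "path_control Y \<psi> \<alpha>"
  shows "path_control (X \<squnion>\<^sub>p Y) (concat_control (end_time X) \<phi> \<psi>) \<alpha>"
proof -
  interpret X: path_control X \<phi> \<alpha> by fact
  interpret Y: path_control Y \<psi> \<alpha> by fact
  note cs = X.control_axioms Y.control_axioms
  interpret Z: control 0 "end_time (X \<squnion>\<^sub>p Y)" "concat_control (end_time X) \<phi> \<psi>" \<alpha>
    using control_concat[OF cs] by simp
  show ?thesis
  proof
    fix i
    have "control_bound (concat_control (end_time X) \<phi> \<psi>) \<alpha> 0 (end_time X + end_time Y)
       (\<lambda>s t. path_at (X \<squnion>\<^sub>p Y) t i - path_at (X \<squnion>\<^sub>p Y) s i)"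
      \<comment> \<open>\<open>E = 0\<close>, since increments of a path are additive across the
        junction.\<close>
      by (rule control_bound_concat[OF cs X.holder_path[of i] Y.holder_path[of i], where E = 0])
         (use X.le Y.le X.alpha in \<open>auto simp: path_at_concat_left path_at_concat_right\<close>)
    then show "control_bound (concat_control (end_time X) \<phi> \<psi>) \<alpha> 0 (end_time (X \<squnion>\<^sub>p Y))
       (\<lambda>s t. path_at (X \<squnion>\<^sub>p Y) t i - path_at (X \<squnion>\<^sub>p Y) s i)"
      by simp
  qed
qed

text \<open>
  Chen's identity. Words are reversed here, so the initial segment \<open>take k w\<close> carries the outer
  integration variables and belongs to the later path \<open>Y\<close>.
\<close>

lemma iterated_integral_concat:
  assumes "path_control X \<phi> \<alpha>" "path_control Y \<psi> \<alpha>" and t: "0 \<le> t" "t \<le> end_time Y"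
  shows "iterated_integral (X \<squnion>\<^sub>p Y) w (end_time X + t) =
    (\<Sum>k\<le>length w. iterated_integral Y (take k w) t * iterated_integral X (drop k w) (end_time X))"
proof -
  interpret X: path_control X \<phi> \<alpha> by fact
  interpret Y: path_control Y \<psi> \<alpha> by fact
  let ?T = "end_time X" and ?U = "end_time Y" and ?Z = "X \<squnion>\<^sub>p Y"
  let ?I = "iterated_integral X" and ?J = "iterated_integral Y" and ?\<chi> = "concat_control (end_time X) \<phi> \<psi>"
  interpret Z: path_control ?Z ?\<chi> \<alpha>
    using assms(1,2) by (rule path_control_concat)
  note cs = X.control_axioms Y.control_axioms and TU = X.end_time_nonneg Y.end_time_nonneg
  \<comment> \<open>\<open>G\<close> is the candidate for the integral along \<open>?Z\<close>: that
    along \<open>X\<close> up to \<open>?T\<close>, afterwards the right-hand side of Chen's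
    identity. The two agree at \<open>?T\<close> because only \<open>k = 0\<close> survives in
    \<open>H w 0\<close>.\<close>
  define H where "H = (\<lambda>w t. \<Sum>k\<le>length w. ?J (take k w) t * ?I (drop k w) ?T)"
  define G where "G = (\<lambda>w t. if t \<le> ?T then ?I w t else H w (t - ?T))"
  have H_0: "H w 0 = ?I w ?T" for w
  proof -
    have "H w 0 = (\<Sum>k\<le>length w. if k = 0 then ?I w ?T else 0)"
      unfolding H_def by (rule sum.cong) (auto simp: Y.iterated_integral_0)
    then show ?thesis by simp
  qed
  have G_left: "G w t = ?I w t" if "t \<le> ?T" for w t
    using that unfolding G_def by simp
  have G_right: "G w t = H w (t - ?T)" if "?T \<le> t" for w t
    using that H_0 unfolding G_def by auto
  \<comment> \<open>The term \<open>k = 0\<close> is constant in time and drops out of increments;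
    in all others the factor along \<open>Y\<close> has a word beginning with \<open>i\<close> and
    is expanded by its differential.\<close>
  have H_Cons: "H (i # w) t = ?I (i # w) ?T + (\<Sum>k\<le>length w. ?I (drop k w) ?T * ?J (i # take k w) t)" for i w t
    unfolding H_def length_Cons sum.atMost_Suc_shift
    by (simp add: mult.commute del: iterated_integral.simps(2))
  have "control_bound ?\<chi> \<alpha> 0 (?T + ?U) (\<lambda>s t. G w t - G w s)" for w
  proof (rule control_bound_concat[OF cs, where E = 0])
    show "control_bound \<phi> \<alpha> 0 ?T (\<lambda>s t. ?I w t - ?I w s)" by (rule X.holder_iterated_integral)
    show "control_bound \<psi> \<alpha> 0 ?U (\<lambda>s t. \<Sum>k\<le>length w. ?I (drop k w) ?T * (?J (take k w) t - ?J (take k w) s))"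
      by (intro control_bound_sum control_bound_cmult Y.holder_iterated_integral)
    show "G w t - G w s = (\<Sum>k\<le>length w. ?I (drop k w) ?T *
        (?J (take k w) (t - ?T) - ?J (take k w) (s - ?T)))" if "?T \<le> s" "s \<le> t" for s t
      using that by (simp add: G_right H_def right_diff_distrib sum_subtractf mult.commute)
  qed (use X.alpha in \<open>auto simp: G_left\<close>)
  then have G_holder: "Z.holder (G w)" for w by simp
  have G_diff: "Z.differential (G w) (\<lambda>t. path_at ?Z t i) (G (i # w))" for i w
  proof -
    obtain C where C: "C \<ge> 0" "\<And>s t. 0 \<le> s \<Longrightarrow> s \<le> t \<Longrightarrow> t \<le> end_time ?Z \<Longrightarrow>
        \<bar>G w t - G w s\<bar> \<le> C * (?\<chi> t - ?\<chi> s) powr \<alpha>"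
      using G_holder by (rule control_boundE) blast
    obtain D where D: "D \<ge> 0" "\<And>s t. 0 \<le> s \<Longrightarrow> s \<le> t \<Longrightarrow> t \<le> end_time ?Z \<Longrightarrow>
        \<bar>path_at ?Z t i - path_at ?Z s i\<bar> \<le> D * (?\<chi> t - ?\<chi> s) powr \<alpha>"
      using Z.holder_path[of i] by (rule control_boundE) blast
    let ?R = "\<lambda>s t. G (i # w) t - G (i # w) s - G w s * (path_at ?Z t i - path_at ?Z s i)"
    have "control_bound ?\<chi> (2 * \<alpha>) 0 (?T + ?U) ?R"
    proof (rule control_bound_concat[OF cs, where E = "C * D"])
      show "control_bound \<phi> (2 * \<alpha>) 0 ?T
          (\<lambda>s t. ?I (i # w) t - ?I (i # w) s - ?I w s * (path_at X t i - path_at X s i))"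
        using X.differential_iterated_integral unfolding X.differential_def .
      show "control_bound \<psi> (2 * \<alpha>) 0 ?U (\<lambda>s t. \<Sum>k\<le>length w. ?I (drop k w) ?T *
          (?J (i # take k w) t - ?J (i # take k w) s - ?J (take k w) s * (path_at Y t i - path_at Y s i)))"
        using Y.differential_iterated_integral unfolding Y.differential_def
        by (intro control_bound_sum control_bound_cmult)
      show "?R s t = ?I (i # w) t - ?I (i # w) s - ?I w s * (path_at X t i - path_at X s i)"
        if "0 \<le> s" "s \<le> t" "t \<le> ?T" for s t
        using that TU by (simp add: G_left path_at_concat_left del: iterated_integral.simps)
      show "?R s t = (\<Sum>k\<le>length w. ?I (drop k w) ?T *
          (?J (i # take k w) (t - ?T) - ?J (i # take k w) (s - ?T) -
           ?J (take k w) (s - ?T) * (path_at Y (t - ?T) i - path_at Y (s - ?T) i)))"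
        if "?T \<le> s" "s \<le> t" "t \<le> ?T + ?U" for s t
      proof -
        have "H w u * x = (\<Sum>k\<le>length w. ?I (drop k w) ?T * (?J (take k w) u * x))" for u x
          unfolding H_def sum_distrib_right by (simp add: mult_ac)
        then show ?thesis
          using that TU
          by (simp add: G_right H_Cons path_at_concat_right right_diff_distrib[of "iterated_integral _ _ _"]
              sum_subtractf del: iterated_integral.simps)
      qed
      show "\<bar>?R s t - ?R s ?T - ?R ?T t\<bar> \<le> C * D * (?\<chi> t - ?\<chi> s) powr (2 * \<alpha>)"
        if "0 \<le> s" "s \<le> ?T" "?T \<le> t" "t \<le> ?T + ?U" for s t
      proof -
        have mono: "?\<chi> s \<le> ?\<chi> ?T" "?\<chi> ?T \<le> ?\<chi> t"
          using Z.phi_le[of s ?T] Z.phi_le[of ?T t] that TU by auto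
        \<comment> \<open>Additivity fails only because the integrand is frozen at \<open>s\<close>
          instead of \<open>?T\<close>; what remains is a product of two increments.\<close>
        have "?R s t - ?R s ?T - ?R ?T t = (G w ?T - G w s) * (path_at ?Z t i - path_at ?Z ?T i)"
          by (simp add: algebra_simps del: iterated_integral.simps)
        also have "\<bar>\<dots>\<bar> \<le> (C * (?\<chi> ?T - ?\<chi> s) powr \<alpha>) * (D * (?\<chi> t - ?\<chi> ?T) powr \<alpha>)"
          unfolding abs_mult using C D that TU by (intro mult_mono) auto
        also have "\<dots> \<le> (C * (?\<chi> t - ?\<chi> s) powr \<alpha>) * (D * (?\<chi> t - ?\<chi> s) powr \<alpha>)"
          using C(1) D(1) X.alpha mono by (intro mult_mono mult_left_mono powr_mono2) auto
        also have "\<dots> = C * D * (?\<chi> t - ?\<chi> s) powr (2 * \<alpha>)" by (simp add: powr_double)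
        finally show ?thesis .
      qed
    qed (use X.alpha in simp)
    then show ?thesis unfolding Z.differential_def by simp
  qed
  have "iterated_integral ?Z w t = G w t" if "0 \<le> t" "t \<le> ?T + ?U" for t
    using that
  proof (induction w arbitrary: t)
    case Nil
    then show ?case by (simp add: G_def H_def)
  next
    case (Cons i w)
    \<comment> \<open>The induction hypothesis replaces the integrand \<open>G w\<close> by the true
      iterated integral; uniqueness of integrals then identifies \<open>G (i # w)\<close>.\<close>
    have "Z.differential (iterated_integral ?Z w) (\<lambda>t. path_at ?Z t i) (G (i # w))"
      using G_diff unfolding Z.differential_def
      by (rule control_bound_subst) (simp add: Cons.IH)
    then have "iterated_integral ?Z (i # w) t = G (i # w) t - G (i # w) 0"
      using Z.rs_integral_differential[OF Z.holder_iterated_integral Z.holder_path] Cons.prems by simp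
    also have "G (i # w) 0 = 0"
      using G_left[of 0 "i # w"] TU X.iterated_integral_0[of "i # w"] by simp
    finally show ?case by simp
  qed
  then show ?thesis
    using t TU G_right[of "?T + t" w] unfolding H_def by simp
qed

section \<open>Paths of finite variation and controls\<close>

text \<open>Sums over chains of points, possibly repeated, from 0 to the second argument. Building
  them from left to right gives an induction on the last cell, which the unordered cells of a
  \<open>division_of\<close> do not offer.\<close>

inductive partition_sum :: "(real \<Rightarrow> real \<Rightarrow> real) \<Rightarrow> real \<Rightarrow> real \<Rightarrow> bool" for h where
  start: "partition_sum h 0 0"
| step: "partition_sum h b S \<Longrightarrow> b \<le> c \<Longrightarrow> partition_sum h c (S + h b c)"

lemma partition_sum_single: "0 \<le> t \<Longrightarrow> partition_sum h t (0 + h 0 t)"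
  by (intro partition_sum.intros)

lemma partition_sum_nonneg: "partition_sum h t S \<Longrightarrow> 0 \<le> t"
  by (induction rule: partition_sum.induct) auto

definition variation :: "(real \<Rightarrow> real \<Rightarrow> real) \<Rightarrow> real \<Rightarrow> real" where
  "variation h t = Sup {S. partition_sum h t S}"

lemma partition_sum_le_variation:
  assumes bound: "\<forall>t\<le>T. \<forall>S. partition_sum h t S \<longrightarrow> S \<le> B"
    and "partition_sum h t S" "t \<le> T"
  shows "S \<le> variation h t"
  unfolding variation_def
  by (rule cSup_upper) (use assms in \<open>auto intro!: bdd_aboveI[of _ B]\<close>)

lemma variation_leI:
  assumes "0 \<le> t" "\<And>S. partition_sum h t S \<Longrightarrow> S \<le> B"
  shows "variation h t \<le> B"
  unfolding variation_def
  by (rule cSup_least) (use assms partition_sum_single in blast)+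

lemma variation_superadditive:
  assumes bound: "\<forall>t\<le>T. \<forall>S. partition_sum h t S \<longrightarrow> S \<le> B"
    and st: "0 \<le> s" "s \<le> t" "t \<le> T"
  shows "variation h s + h s t \<le> variation h t"
proof -
  have "variation h s \<le> variation h t - h s t"
  proof (rule variation_leI[OF st(1)])
    fix S assume "partition_sum h s S"
    then have "partition_sum h t (S + h s t)" using st(2) by (rule partition_sum.step)
    then have "S + h s t \<le> variation h t"
      using st(3) by (rule partition_sum_le_variation[OF bound])
    then show "S \<le> variation h t - h s t" by simp
  qed
  then show ?thesis by simp
qed

text \<open>
  The \<open>p\<close>-variation itself need not be shown continuous: for \<open>q > p\<close> the terms of the
  \<open>q\<close>-variation on a short interval are small multiples of those of the \<open>p\<close>-variation, which
  makes the \<open>q\<close>-variation continuous by elementary means.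
\<close>

lemma ex_control:
  fixes N :: "real \<Rightarrow> real \<Rightarrow> real"
  assumes T: "0 \<le> T" and pq: "0 < p" "p < q" "q < 2"
    and N_nonneg: "\<And>s t. 0 \<le> N s t"
    and triangle: "\<And>s u t. N s t \<le> N s u + N u t"
    and small: "\<And>e. e > 0 \<Longrightarrow>
      \<exists>\<delta>>0. \<forall>s t. 0 \<le> s \<longrightarrow> s \<le> t \<longrightarrow> t \<le> T \<longrightarrow> t - s < \<delta> \<longrightarrow> N s t < e"
    and bound: "\<forall>t\<le>T. \<forall>S. partition_sum (\<lambda>s t. N s t powr p) t S \<longrightarrow> S \<le> B"
  obtains \<phi> where "control 0 T \<phi> (1 / q)"
    "\<And>s t. 0 \<le> s \<Longrightarrow> s \<le> t \<Longrightarrow> t \<le> T \<Longrightarrow> N s t \<le> (\<phi> t - \<phi> s) powr (1 / q)"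
proof -
  define V where "V = variation (\<lambda>s t. N s t powr p)"
  define W where "W = variation (\<lambda>s t. N s t powr q)"
  have V: "N s t powr p \<le> V t - V s" if "0 \<le> s" "s \<le> t" "t \<le> T" for s t
    using variation_superadditive[OF bound that] unfolding V_def by simp
  have V_mono: "V s \<le> V t" if "0 \<le> s" "s \<le> t" "t \<le> T" for s t
    using V[OF that] powr_ge_zero[of "N s t" p] by linarith
  define M where "M = (V T - V 0) powr (1 / p)"
  have N_le: "N s t \<le> M" if "0 \<le> s" "s \<le> t" "t \<le> T" for s t
  proof -
    have "N s t = (N s t powr p) powr (1 / p)"
      using pq(1) N_nonneg by (simp add: powr_powr)
    also have "\<dots> \<le> M"
      unfolding M_def using V[OF that] V_mono[of 0 s] V_mono[of t T] that pq(1)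
      by (intro powr_mono2) auto
    finally show ?thesis .
  qed
  \<comment> \<open>The surplus exponent \<open>q - p\<close> converts smallness of \<open>N\<close>
    into smallness of the q-sums.\<close>
  have power_le: "N s t powr q \<le> k powr (q - p) * (V t - V s)"
    if "0 \<le> s" "s \<le> t" "t \<le> T" "N s t \<le> k" for s t k
  proof -
    have "N s t powr q = N s t powr (q - p) * N s t powr p" by (simp flip: powr_add)
    also have "\<dots> \<le> k powr (q - p) * (V t - V s)"
      using that V[of s t] N_nonneg pq by (intro mult_mono powr_mono2) auto
    finally show ?thesis .
  qed
  have "S \<le> M powr (q - p) * (V t - V 0)" if "partition_sum (\<lambda>s t. N s t powr q) t S" "t \<le> T" for t S
    using that
  proof (induction rule: partition_sum.induct)
    case (step b S c)
    then have "0 \<le> b" "b \<le> T" using partition_sum_nonneg by auto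
    then show ?case
      using step power_le[of b c M] N_le[of b c] by (simp add: right_diff_distrib)
  qed simp
  moreover have "M powr (q - p) * (V t - V 0) \<le> M powr (q - p) * (V T - V 0)"
    if "partition_sum (\<lambda>s t. N s t powr q) t S" "t \<le> T" for t S
    using that partition_sum_nonneg[of _ t S] V_mono[of t T] by (intro mult_left_mono) auto
  ultimately have bound_q: "\<forall>t\<le>T. \<forall>S. partition_sum (\<lambda>s t. N s t powr q) t S \<longrightarrow>
      S \<le> M powr (q - p) * (V T - V 0)"
    using order_trans by blast
  note W_upper = partition_sum_le_variation[OF bound_q, folded W_def]
  have W: "N s t powr q \<le> W t - W s" if "0 \<le> s" "s \<le> t" "t \<le> T" for s t
    using variation_superadditive[OF bound_q that] unfolding W_def by simp
  have W_mono: "W s \<le> W t" if "0 \<le> s" "s \<le> t" "t \<le> T" for s t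
    using W[OF that] powr_ge_zero[of "N s t" q] by linarith
  have W_cont: "\<exists>\<delta>>0. \<forall>s t. 0 \<le> s \<longrightarrow> s \<le> t \<longrightarrow> t \<le> T \<longrightarrow> t - s < \<delta> \<longrightarrow> W t - W s \<le> e"
    if e: "e > 0" for e
  proof -
    \<comment> \<open>Prepares the cut of a cell across \<open>s\<close>: the triangle inequality
      replaces \<open>N b c\<close> by \<open>N b s + N s c\<close>, which is at most
      \<open>2 * M\<close>.\<close>
    have "continuous_on {0..2 * M} (\<lambda>x. x powr q)"
      using pq by (intro continuous_on_powr' continuous_intros) auto
    then have "uniformly_continuous_on {0..2 * M} (\<lambda>x. x powr q)"
      by (rule compact_uniformly_continuous) simp
    then have "\<exists>\<eta>>0. \<forall>x\<in>{0..2 * M}. \<forall>y\<in>{0..2 * M}. dist y x < \<eta> \<longrightarrow> dist (y powr q) (x powr q) < e / 2"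
      using e unfolding uniformly_continuous_on_def by (meson half_gt_zero)
    then obtain \<eta> where \<eta>: "\<eta> > 0"
      "\<And>x y. x \<in> {0..2 * M} \<Longrightarrow> y \<in> {0..2 * M} \<Longrightarrow> dist y x < \<eta> \<Longrightarrow> dist (y powr q) (x powr q) < e / 2"
      by blast
    \<comment> \<open>\<open>k\<close> is such that all cells to the right of \<open>s\<close>
      together contribute at most \<open>e / 2\<close>; the summand 1 keeps \<open>D\<close>
      positive.\<close>
    define D where "D = V T - V 0 + 1"
    have D: "D > 0" unfolding D_def using V_mono[of 0 T] T by simp
    define k where "k = (e / (2 * D)) powr (1 / (q - p))"
    have k: "k > 0" "k powr (q - p) = e / (2 * D)"
      unfolding k_def using e D pq by (simp_all add: powr_powr)
    obtain \<delta> where \<delta>: "\<delta> > 0"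
      "\<And>s t. 0 \<le> s \<Longrightarrow> s \<le> t \<Longrightarrow> t \<le> T \<Longrightarrow> t - s < \<delta> \<Longrightarrow> N s t < min k \<eta>"
      using small[of "min k \<eta>"] k \<eta> by auto
    \<comment> \<open>Cells to the right of \<open>s\<close> are charged to \<open>V\<close>. The
      cell that starts before \<open>s\<close> and reaches it is cut at \<open>s\<close> at the
      single cost \<open>e / 2\<close>, and the chain thus closed at \<open>s\<close> is bounded by
      \<open>W s\<close>.\<close>
    have claim: "S \<le> W s + e / 2 + k powr (q - p) * (V t - V s)"
      if "partition_sum (\<lambda>s t. N s t powr q) t S" "0 \<le> s" "s \<le> t" "t \<le> T" "t - s < \<delta>" for s t S
      using that
    proof (induction rule: partition_sum.induct)
      case start
      then show ?case
        using W_upper[OF partition_sum.start] T e by auto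
    next
      case (step b S c)
      have b: "0 \<le> b" using step.hyps(1) by (rule partition_sum_nonneg)
      show ?case
      proof (cases "s \<le> b")
        case True
        have "N b c powr q \<le> k powr (q - p) * (V c - V b)"
          using \<delta>(2)[of b c] b step True by (intro power_le) auto
        moreover have "S \<le> W s + e / 2 + k powr (q - p) * (V b - V s)"
          using step True by auto
        ultimately show ?thesis by (simp add: right_diff_distrib)
      next
        case False
        have "partition_sum (\<lambda>s t. N s t powr q) s (S + N b s powr q)"
          using step.hyps(1) False by (intro partition_sum.step) auto
        then have 1: "S + N b s powr q \<le> W s"
          by (rule W_upper) (use step in auto)
        have "N s c < min k \<eta>" using \<delta>(2)[of s c] step by auto
        then have "dist ((N b s + N s c) powr q) (N b s powr q) < e / 2"
          using N_le[of b s] N_le[of s c] N_nonneg[of b s] N_nonneg[of s c] b step False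
          by (intro \<eta>(2)) (auto simp: dist_real_def)
        moreover have "N b c powr q \<le> (N b s + N s c) powr q"
          using triangle N_nonneg pq by (intro powr_mono2) auto
        ultimately have 2: "N b c powr q \<le> N b s powr q + e / 2"
          unfolding dist_real_def by linarith
        have "0 \<le> k powr (q - p) * (V c - V s)"
          using V_mono[of s c] step by (intro mult_nonneg_nonneg) auto
        with 1 2 show ?thesis by linarith
      qed
    qed
    have "W t - W s \<le> e" if st: "0 \<le> s" "s \<le> t" "t \<le> T" "t - s < \<delta>" for s t
    proof -
      have "W t \<le> W s + e / 2 + k powr (q - p) * (V t - V s)"
        unfolding W_def using st claim unfolding W_def by (intro variation_leI) auto
      also have "k powr (q - p) * (V t - V s) \<le> (e / (2 * D)) * D"
        unfolding k(2) D_def[symmetric]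
        using V_mono[of 0 s] V_mono[of t T] st e D by (intro mult_left_mono) (auto simp: D_def)
      also have "(e / (2 * D)) * D = e / 2" using D by simp
      finally show ?thesis by simp
    qed
    then show ?thesis using \<delta>(1) by blast
  qed
  have "continuous_on {0..T} W"
    unfolding continuous_on_iff
  proof (intro ballI allI impI)
    fix s e :: real assume s: "s \<in> {0..T}" and e: "e > 0"
    obtain \<delta> where \<delta>: "\<delta> > 0"
      "\<And>s t. 0 \<le> s \<Longrightarrow> s \<le> t \<Longrightarrow> t \<le> T \<Longrightarrow> t - s < \<delta> \<Longrightarrow> W t - W s \<le> e / 2"
      using W_cont[of "e / 2"] e by auto
    have "dist (W t) (W s) < e" if t: "t \<in> {0..T}" "dist t s < \<delta>" for t
      using \<delta>(2)[of s t] \<delta>(2)[of t s] W_mono[of s t] W_mono[of t s] s t e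
      by (cases "s \<le> t") (auto simp: dist_real_def)
    then show "\<exists>d>0. \<forall>t\<in>{0..T}. dist t s < d \<longrightarrow> dist (W t) (W s) < e"
      using \<delta>(1) by blast
  qed
  then have "control 0 T (\<lambda>t. W t + t) (1 / q)"
    using T pq W_mono
    by unfold_locales (auto intro!: strict_mono_onI continuous_intros add_le_less_mono)
  moreover have "N s t \<le> ((W t + t) - (W s + s)) powr (1 / q)" if "0 \<le> s" "s \<le> t" "t \<le> T" for s t
  proof -
    have "N s t = (N s t powr q) powr (1 / q)"
      using pq N_nonneg by (simp add: powr_powr)
    also have "\<dots> \<le> ((W t + t) - (W s + s)) powr (1 / q)"
      using W[OF that] that pq by (intro powr_mono2) auto
    finally show ?thesis .
  qed
  ultimately show ?thesis by (rule that)
qed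

section \<open>Divisions, and the equivalence of finite variation with a control\<close>

lemma division_of_extend:
  fixes s t :: real
  assumes "P division_of {0..s}" "0 \<le> s" "s \<le> t"
  shows "insert {s..t} P division_of {0..t}"
proof -
  have "{{s..t}} division_of {s..t}"
    using assms division_of_self[of s t] by (simp add: box_real)
  then have "{{s..t}} \<union> P division_of {s..t} \<union> {0..s}"
    using assms(1) by (rule division_disjoint_union) (simp add: interior_atLeastAtMost_real)
  moreover have "{s..t} \<union> {0..s} = {0..t}" using assms by auto
  ultimately show ?thesis by simp
qed

lemma partition_sum_division:
  assumes "partition_sum h t S" and diag: "\<And>s. h s s = 0"
  shows "\<exists>P. P division_of {0..t} \<and> S = (\<Sum>K\<in>P. h (Inf K) (Sup K))"
  using assms(1)
proof (induction rule: partition_sum.induct)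
  case start
  have "{{0..0}} division_of {0..0::real}"
    using division_of_self[of 0 "0::real"] by (simp add: box_real)
  then show ?case by (intro exI[of _ "{{0..0}}"]) (simp add: diag)
next
  case (step b S c)
  then obtain P where P: "P division_of {0..b}" "S = (\<Sum>K\<in>P. h (Inf K) (Sup K))" by blast
  have b: "0 \<le> b" using step.hyps(1) by (rule partition_sum_nonneg)
  have "(\<Sum>K\<in>insert {b..c} P. h (Inf K) (Sup K)) = S + h b c"
  \<comment> \<open>A division is a set, so a repeated cell is counted once. Only a degenerate cell
    can repeat, and it contributes 0 by \<open>diag\<close>.\<close>
  proof (cases "{b..c} \<in> P")
    case True
    then have "{b..c} \<subseteq> {0..b}" using division_ofD(2)[OF P(1)] by blast
    then have "b = c" using step.hyps(2) by auto
    then show ?thesis using True P(2) diag by (simp add: insert_absorb)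
  next
    case False
    then show ?thesis using division_ofD(1)[OF P(1)] P(2) step.hyps(2) by simp
  qed
  then show ?case using division_of_extend[OF P(1) b step.hyps(2)] by metis
qed

text \<open>Tagging each cell by its left end makes the telescoping of tagged divisions
  applicable.\<close>

lemma sum_division_telescope:
  fixes f :: "real \<Rightarrow> real"
  assumes P: "P division_of {a..b}" and "a \<le> b"
  shows "(\<Sum>K\<in>P. f (Sup K) - f (Inf K)) = f b - f a"
proof -
  have K: "Inf K \<in> K \<and> K \<subseteq> {a..b} \<and> (\<exists>s t. K = cbox s t)" if K: "K \<in> P" for K
  proof -
    obtain s t where "K = {s..t}" "K \<noteq> {}" "K \<subseteq> {a..b}"
      using division_ofD(2-4)[OF P K] by auto
    then show ?thesis by auto
  qed
  have "(\<lambda>K. (Inf K, K)) ` P tagged_division_of {a..b}"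
  proof (rule tagged_division_ofI)
    show "finite ((\<lambda>K. (Inf K, K)) ` P)" using division_ofD(1)[OF P] by simp
    show "\<Union> {K. \<exists>x. (x, K) \<in> (\<lambda>K. (Inf K, K)) ` P} = {a..b}"
    proof -
      have "{K. \<exists>x. (x, K) \<in> (\<lambda>K. (Inf K, K)) ` P} = P" by auto
      then show ?thesis using division_ofD(6)[OF P] by simp
    qed
  qed (use K division_ofD(5)[OF P] in auto)
  from additive_tagged_division_1[OF assms(2) this, of f] show ?thesis
    by (simp add: sum.reindex inj_on_def)
qed

lemma abs_le_L2_set: "finite A \<Longrightarrow> i \<in> A \<Longrightarrow> \<bar>f i\<bar> \<le> L2_set f A"
  unfolding L2_set_def
  using member_le_sum[of i A "\<lambda>i. (f i)\<^sup>2"] by (intro real_le_rsqrt) simp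

lemma path_control_weaken:
  assumes "path_control X \<phi> \<alpha>" "1 / 2 < \<beta>" "\<beta> \<le> \<alpha>"
  shows "path_control X \<phi> \<beta>"
proof -
  interpret path_control X \<phi> \<alpha> by fact
  show ?thesis
  proof
    show "control_bound \<phi> \<beta> 0 (end_time X) (\<lambda>s t. path_at X t i - path_at X s i)" for i
      using holder_path phi_mono assms(3) by (rule control_bound_weaken)
  qed (use le strict cont assms in auto)
qed

text \<open>\<open>ex_control\<close> with some q between p and 2 yields \<alpha> = 1/q. The bound
  \<alpha> \<le> 1, from q > p \<ge> 1, is recorded because \<open>pathsI\<close> needs it to return
  to an exponent of at least 1.\<close>

lemma paths_control:
  assumes X: "X \<in> paths d"
  obtains \<phi> \<alpha> where "path_control X \<phi> \<alpha>" "\<alpha> \<le> 1"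
proof -
  let ?T = "end_time X"
  define N where "N = (\<lambda>s t. L2_set (\<lambda>i. path_at X t i - path_at X s i) {..<d})"
  obtain p where p: "1 \<le> p" "p < 2" "finite_p_variation d p X"
    using X unfolding paths_def by blast
  have T: "0 < ?T" and cont: "continuous_on {0..?T} (path_at X)"
    and range: "\<And>t. t \<in> {0..?T} \<Longrightarrow> path_at X t \<in> rvec d"
    using X unfolding paths_def by (auto simp: PiE_iff)
  obtain B where B: "\<And>P. P division_of {0..?T} \<Longrightarrow> (\<Sum>K\<in>P. N (Inf K) (Sup K) powr p) \<le> B"
    using p(3) unfolding finite_p_variation_def bdd_above_def N_def by blast
  have diag: "N s s powr p = 0" for s
    unfolding N_def by (simp add: L2_set_0')
  \<comment> \<open>Finite variation concerns divisions of the whole interval, so a chain ending at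
    \<open>t\<close> is first extended by one cell.\<close>
  have bound: "S \<le> B" if "t \<le> ?T" "partition_sum (\<lambda>s t. N s t powr p) t S" for t S
  proof -
    have "partition_sum (\<lambda>s t. N s t powr p) ?T (S + N t ?T powr p)"
      using that by (intro partition_sum.step) auto
    from partition_sum_division[OF this diag] have "S + N t ?T powr p \<le> B"
      using B by auto
    then show ?thesis using powr_ge_zero[of "N t ?T" p] by linarith
  qed
  have triangle: "N s t \<le> N s u + N u t" for s u t
    using L2_set_triangle_ineq[of "\<lambda>i. path_at X u i - path_at X s i" "\<lambda>i. path_at X t i - path_at X u i" "{..<d}"]
    unfolding N_def by simp
  \<comment> \<open>Uniform continuity of \<open>N\<close> on the square, compared with the
    diagonal, where \<open>N\<close> vanishes.\<close>
  have small: "\<exists>\<delta>>0. \<forall>s t. 0 \<le> s \<longrightarrow> s \<le> t \<longrightarrow> t \<le> ?T \<longrightarrow> t - s < \<delta> \<longrightarrow> N s t < e" if e: "e > 0" for e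
  proof -
    let ?Q = "{0..?T} \<times> {0..?T}"
    have "continuous_on {0..?T} (\<lambda>t. path_at X t i)" for i
      using cont by (rule continuous_on_product_then_coordinatewise)
    then have "continuous_on ?Q (\<lambda>z. path_at X (fst z) i)" "continuous_on ?Q (\<lambda>z. path_at X (snd z) i)" for i
      by (rule continuous_on_compose2, (auto intro!: continuous_intros)[2])+
    then have "continuous_on ?Q (\<lambda>z. N (fst z) (snd z))"
      unfolding N_def L2_set_def by (intro continuous_intros)
    then have "uniformly_continuous_on ?Q (\<lambda>z. N (fst z) (snd z))"
      by (rule compact_uniformly_continuous) (simp add: compact_Times)
    from this[unfolded uniformly_continuous_on_def, rule_format, OF e]
    obtain \<delta> where \<delta>: "\<delta> > 0" "\<And>z z'. z \<in> ?Q \<Longrightarrow> z' \<in> ?Q \<Longrightarrow> dist z' z < \<delta> \<Longrightarrow>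
        dist (N (fst z') (snd z')) (N (fst z) (snd z)) < e"
      by blast
    have "N s t < e" if "0 \<le> s" "s \<le> t" "t \<le> ?T" "t - s < \<delta>" for s t
    proof -
      have "dist (N s t) (N s s) < e"
        using \<delta>(2)[of "(s, s)" "(s, t)"] that by (simp add: dist_Pair_Pair dist_real_def)
      moreover have "N s s = 0" unfolding N_def by (simp add: L2_set_0')
      ultimately show ?thesis by (simp add: dist_real_def)
    qed
    then show ?thesis using \<delta>(1) by blast
  qed
  obtain q where q: "p < q" "q < 2" using dense[OF p(2)] by blast
  obtain \<phi> where \<phi>: "control 0 ?T \<phi> (1 / q)"
    "\<And>s t. 0 \<le> s \<Longrightarrow> s \<le> t \<Longrightarrow> t \<le> ?T \<Longrightarrow> N s t \<le> (\<phi> t - \<phi> s) powr (1 / q)"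
    using ex_control[of ?T p q N B] T p q triangle small bound unfolding N_def by auto
  interpret control 0 ?T \<phi> "1 / q" by fact
  have "path_control X \<phi> (1 / q)"
  proof
    fix i
    show "holder (\<lambda>t. path_at X t i)"
    proof (rule control_boundI[where C = 1])
      fix s t assume st: "0 \<le> s" "s \<le> t" "t \<le> ?T"
      show "\<bar>path_at X t i - path_at X s i\<bar> \<le> 1 * (\<phi> t - \<phi> s) powr (1 / q)"
      proof (cases "i < d")
        case True
        then have "\<bar>path_at X t i - path_at X s i\<bar> \<le> N s t"
          unfolding N_def by (intro abs_le_L2_set[of "{..<d}" i "\<lambda>i. path_at X t i - path_at X s i"]) auto
        then show ?thesis using \<phi>(2)[OF st] by simp
      next
        case False
        then show ?thesis using range[of s] range[of t] st by (simp add: rvec_def)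
      qed
    qed
  qed
  then show ?thesis using that[of \<phi> "1 / q"] p q by simp
qed

text \<open>The converse of \<open>paths_control\<close>, used for concatenations and components.
  With p = 1/\<alpha>, which lies in [1,2), the p-th power of an increment is at most a multiple of
  \<Delta>\<phi>, and that telescopes.\<close>

lemma pathsI:
  assumes "path_control X \<phi> \<alpha>" "\<alpha> \<le> 1" "0 < end_time X"
    and range: "path_at X \<in> {0..end_time X} \<rightarrow>\<^sub>E rvec d"
  shows "X \<in> paths d"
proof -
  interpret path_control X \<phi> \<alpha> by fact
  let ?T = "end_time X"
  have "continuous_on {0..?T} (\<lambda>t. path_at X t i)" for i
    unfolding continuous_on_def
  proof
    fix s assume s: "s \<in> {0..?T}"
    obtain C where C: "\<And>s t. 0 \<le> s \<Longrightarrow> s \<le> t \<Longrightarrow> t \<le> ?T \<Longrightarrow>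
        \<bar>path_at X t i - path_at X s i\<bar> \<le> C * (\<phi> t - \<phi> s) powr \<alpha>"
      using holder_path[of i] by (rule control_boundE) blast
    have "continuous_on {0..?T} (\<lambda>t. C * \<bar>\<phi> t - \<phi> s\<bar> powr \<alpha>)"
      using cont alpha by (intro continuous_intros continuous_on_powr') auto
    then have "((\<lambda>t. C * \<bar>\<phi> t - \<phi> s\<bar> powr \<alpha>) \<longlongrightarrow> 0) (at s within {0..?T})"
      using s unfolding continuous_on_def by fastforce
    then have "((\<lambda>t. path_at X t i - path_at X s i) \<longlongrightarrow> 0) (at s within {0..?T})"
    proof (rule Lim_null_comparison[rotated])
      have "\<bar>path_at X t i - path_at X s i\<bar> \<le> C * \<bar>\<phi> t - \<phi> s\<bar> powr \<alpha>" if "t \<in> {0..?T}" for t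
        using C[of s t] C[of t s] phi_le[of s t] phi_le[of t s] s that
        by (cases "s \<le> t") (auto simp: abs_minus_commute)
      then show "\<forall>\<^sub>F t in at s within {0..?T}.
          norm (path_at X t i - path_at X s i) \<le> C * \<bar>\<phi> t - \<phi> s\<bar> powr \<alpha>"
        by (auto simp: eventually_at_filter)
    qed
    then show "((\<lambda>t. path_at X t i) \<longlongrightarrow> path_at X s i) (at s within {0..?T})"
      by (rule LIM_zero_cancel)
  qed
  then have "continuous_on {0..?T} (path_at X)"
    by (rule continuous_on_coordinatewise_then_product)
  moreover have "finite_p_variation d (1 / \<alpha>) X"
  proof -
    have "\<exists>C. 0 \<le> C \<and> (\<forall>s t. 0 \<le> s \<longrightarrow> s \<le> t \<longrightarrow> t \<le> ?T \<longrightarrow>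
        \<bar>path_at X t i - path_at X s i\<bar> \<le> C * (\<phi> t - \<phi> s) powr \<alpha>)" for i
      using holder_path[of i] by (rule control_boundE) blast
    then obtain C where C: "\<And>i. 0 \<le> C i" "\<And>i s t. 0 \<le> s \<Longrightarrow> s \<le> t \<Longrightarrow> t \<le> ?T \<Longrightarrow>
        \<bar>path_at X t i - path_at X s i\<bar> \<le> C i * (\<phi> t - \<phi> s) powr \<alpha>"
      by metis
    define D where "D = (\<Sum>i<d. C i)"
    have D: "D \<ge> 0" unfolding D_def using C(1) by (rule sum_nonneg)
    have term_bound: "L2_set (\<lambda>i. path_at X t i - path_at X s i) {..<d} powr (1 / \<alpha>) \<le>
        D powr (1 / \<alpha>) * (\<phi> t - \<phi> s)"
      if st: "0 \<le> s" "s \<le> t" "t \<le> ?T" for s t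
    proof -
      have "L2_set (\<lambda>i. path_at X t i - path_at X s i) {..<d} \<le> (\<Sum>i<d. \<bar>path_at X t i - path_at X s i\<bar>)"
        by (rule L2_set_le_sum_abs)
      also have "\<dots> \<le> D * (\<phi> t - \<phi> s) powr \<alpha>"
        unfolding D_def sum_distrib_right using C(2)[OF st] by (rule sum_mono)
      finally have "L2_set (\<lambda>i. path_at X t i - path_at X s i) {..<d} powr (1 / \<alpha>) \<le>
          (D * (\<phi> t - \<phi> s) powr \<alpha>) powr (1 / \<alpha>)"
        using alpha by (intro powr_mono2) auto
      also have "\<dots> = D powr (1 / \<alpha>) * (\<phi> t - \<phi> s)"
        using D alpha phi_le[OF st] by (simp add: powr_mult powr_powr)
      finally show ?thesis .
    qed
    show ?thesis
      unfolding finite_p_variation_def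
    proof (rule bdd_aboveI[of _ "D powr (1 / \<alpha>) * (\<phi> ?T - \<phi> 0)"], safe)
      fix P assume P: "P division_of {0..?T}"
      have "(\<Sum>K\<in>P. L2_set (\<lambda>i. path_at X (Sup K) i - path_at X (Inf K) i) {..<d} powr (1 / \<alpha>)) \<le>
          (\<Sum>K\<in>P. D powr (1 / \<alpha>) * (\<phi> (Sup K) - \<phi> (Inf K)))"
      proof (rule sum_mono)
        fix K assume "K \<in> P"
        then obtain s t where "K = {s..t}" "K \<noteq> {}" "K \<subseteq> {0..?T}"
          using division_ofD(2-4)[OF P] by (metis box_real(2))
        then show "L2_set (\<lambda>i. path_at X (Sup K) i - path_at X (Inf K) i) {..<d} powr (1 / \<alpha>) \<le>
            D powr (1 / \<alpha>) * (\<phi> (Sup K) - \<phi> (Inf K))"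
          using term_bound[of s t] by auto
      qed
      also have "\<dots> = D powr (1 / \<alpha>) * (\<phi> ?T - \<phi> 0)"
        using sum_division_telescope[OF P le, of \<phi>] by (simp flip: sum_distrib_left)
      finally show "(\<Sum>K\<in>P. L2_set (\<lambda>i. path_at X (Sup K) i - path_at X (Inf K) i) {..<d} powr (1 / \<alpha>)) \<le>
          D powr (1 / \<alpha>) * (\<phi> ?T - \<phi> 0)" .
    qed
  qed
  moreover have "1 \<le> 1 / \<alpha>" "1 / \<alpha> < 2" using alpha assms(2) by (auto simp: field_simps)
  ultimately show ?thesis
    using assms(3) range unfolding paths_def by blast
qed

section \<open>Functionals represented by the signature\<close>

lemma paths_control2:
  assumes "X \<in> paths d" "Y \<in> paths d"
  obtains \<phi> \<psi> \<alpha> where "path_control X \<phi> \<alpha>" "path_control Y \<psi> \<alpha>" "\<alpha> \<le> 1"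
proof -
  obtain \<phi> \<beta> where X: "path_control X \<phi> \<beta>" "\<beta> \<le> 1" using assms(1) by (rule paths_control)
  obtain \<psi> \<gamma> where Y: "path_control Y \<psi> \<gamma>" "\<gamma> \<le> 1" using assms(2) by (rule paths_control)
  interpret X: path_control X \<phi> \<beta> by fact
  interpret Y: path_control Y \<psi> \<gamma> by fact
  have "1 / 2 < min \<beta> \<gamma>" using X.alpha Y.alpha by simp
  then show ?thesis
    using that[of \<phi> "min \<beta> \<gamma>" \<psi>] path_control_weaken[OF X(1)] path_control_weaken[OF Y(1)] X(2) by simp
qed

lemma paths_concat:
  assumes X: "X \<in> paths d" and Y: "Y \<in> paths d"
  shows "X \<squnion>\<^sub>p Y \<in> paths d"
proof -
  obtain \<phi> \<psi> \<alpha> where c: "path_control X \<phi> \<alpha>" "path_control Y \<psi> \<alpha>" "\<alpha> \<le> 1"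
    using X Y by (rule paths_control2)
  have T: "0 < end_time X" "0 < end_time Y"
    and range: "\<And>t. 0 \<le> t \<Longrightarrow> t \<le> end_time X \<Longrightarrow> path_at X t \<in> rvec d"
      "\<And>t. 0 \<le> t \<Longrightarrow> t \<le> end_time Y \<Longrightarrow> path_at Y t \<in> rvec d"
    using X Y by (auto simp: paths_def PiE_iff)
  show ?thesis
  proof (rule pathsI[OF path_control_concat[OF c(1,2)] c(3)])
    have "path_at (X \<squnion>\<^sub>p Y) t \<in> rvec d" if "0 \<le> t" "t \<le> end_time X + end_time Y" for t
      using that T range(1)[of t] range(1)[of "end_time X"] range(2)[of "t - end_time X"] range(2)[of 0]
      by (auto simp: path_concat_def rvec_def)
    moreover have "path_at (X \<squnion>\<^sub>p Y) \<in> extensional {0..end_time (X \<squnion>\<^sub>p Y)}"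
      by (simp add: path_concat_def)
    ultimately show "path_at (X \<squnion>\<^sub>p Y) \<in> {0..end_time (X \<squnion>\<^sub>p Y)} \<rightarrow>\<^sub>E rvec d"
      by (simp add: PiE_iff)
  qed (use T in simp)
qed

lemma signature_concat:
  assumes "X \<in> paths d" "Y \<in> paths d"
  shows "signature (X \<squnion>\<^sub>p Y) w = (\<Sum>k\<le>length w. signature X (take k w) * signature Y (drop k w))"
proof -
  obtain \<phi> \<psi> \<alpha> where c: "path_control X \<phi> \<alpha>" "path_control Y \<psi> \<alpha>"
    using assms by (rule paths_control2)
  have "0 \<le> end_time Y" using c(2) by (rule path_control.end_time_nonneg)
  then have "signature (X \<squnion>\<^sub>p Y) w = (\<Sum>k\<le>length w.
      iterated_integral Y (take k (rev w)) (end_time Y) * iterated_integral X (drop k (rev w)) (end_time X))"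
    using iterated_integral_concat[OF c, of "end_time Y" "rev w"] by (simp add: signature_def)
  \<comment> \<open>Undoing the reversal of the word exchanges initial and final segments and counts
    \<open>k\<close> from the other end.\<close>
  also have "\<dots> = (\<Sum>k\<le>length w. signature X (take (length w - k) w) * signature Y (drop (length w - k) w))"
    by (rule sum.cong) (simp_all add: signature_def take_rev drop_rev mult.commute)
  also have "\<dots> = (\<Sum>k\<le>length w. signature X (take k w) * signature Y (drop k w))"
    by (rule sum.reindex_bij_witness[of _ "\<lambda>k. length w - k" "\<lambda>k. length w - k"]) auto
  finally show ?thesis .
qed

lemma signature_shuffle:
  assumes "X \<in> paths d"
  shows "signature X u * signature X v = (\<Sum>w\<leftarrow>shuffle_words (rev u) (rev v). signature X (rev w))"
proof -
  obtain \<phi> \<alpha> where c: "path_control X \<phi> \<alpha>" using assms by (rule paths_control)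
  show ?thesis
    using path_control.iterated_integral_shuffle[OF c path_control.end_time_nonneg[OF c] order_refl]
    by (simp add: signature_def)
qed

text \<open>Functions on path space that are linear in the signature. They form an algebra and play
  the role of the coordinate ring.\<close>

definition representable :: "nat \<Rightarrow> (path \<Rightarrow> real) \<Rightarrow> bool" where
  "representable d \<Phi> \<longleftrightarrow> (\<exists>x\<in>tensor_algebra d. \<forall>X\<in>paths d. \<Phi> X = dual_pairing (signature X) x)"

lemma representable_cong:
  assumes "representable d \<Phi>" "\<And>X. X \<in> paths d \<Longrightarrow> \<Psi> X = \<Phi> X"
  shows "representable d \<Psi>"
  using assms unfolding representable_def by metis

lemma dual_pairing_superset:
  assumes "finite S" "Poly_Mapping.keys x \<subseteq> S"
  shows "dual_pairing f x = (\<Sum>w\<in>S. Poly_Mapping.lookup x w * f w)"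
  unfolding dual_pairing_def
  by (rule sum.mono_neutral_left) (use assms in \<open>auto simp: in_keys_iff\<close>)

lemma representable_add:
  assumes "representable d \<Phi>" "representable d \<Psi>"
  shows "representable d (\<lambda>X. \<Phi> X + \<Psi> X)"
proof -
  obtain x where x: "x \<in> tensor_algebra d" "\<And>X. X \<in> paths d \<Longrightarrow> \<Phi> X = dual_pairing (signature X) x"
    using assms(1) unfolding representable_def by blast
  obtain y where y: "y \<in> tensor_algebra d" "\<And>X. X \<in> paths d \<Longrightarrow> \<Psi> X = dual_pairing (signature X) y"
    using assms(2) unfolding representable_def by blast
  let ?S = "Poly_Mapping.keys x \<union> Poly_Mapping.keys y"
  have keys: "Poly_Mapping.keys (x + y) \<subseteq> ?S" by (rule Poly_Mapping.keys_add)
  then have "x + y \<in> tensor_algebra d"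
    using x(1) y(1) unfolding tensor_algebra_def by auto
  moreover have "dual_pairing f (x + y) = dual_pairing f x + dual_pairing f y" for f
    using keys by (simp add: dual_pairing_superset[of ?S] lookup_add distrib_right sum.distrib)
  ultimately show ?thesis
    using x(2) y(2) unfolding representable_def by (intro bexI[of _ "x + y"] ballI) simp_all
qed

lemma representable_word:
  assumes "set w \<subseteq> {..<d}"
  shows "representable d (\<lambda>X. c * signature X w)"
proof -
  have "Poly_Mapping.single w c \<in> tensor_algebra d"
    using assms unfolding tensor_algebra_def by (cases "c = 0") auto
  moreover have "dual_pairing f (Poly_Mapping.single w c) = c * f w" for f
    by (simp add: dual_pairing_superset[of "{w}"])
  ultimately show ?thesis
    unfolding representable_def by (intro bexI[of _ "Poly_Mapping.single w c"] ballI) simp_all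
qed

lemma representable_zero: "representable d (\<lambda>X. 0)"
  using representable_word[of "[]" d 0] by simp

lemma representable_sum:
  assumes "\<And>i. i \<in> I \<Longrightarrow> representable d (\<Phi> i)"
  shows "representable d (\<lambda>X. \<Sum>i\<in>I. \<Phi> i X)"
  using assms
  by (induction I rule: infinite_finite_induct) (auto intro: representable_zero representable_add)

lemma representable_sum_list:
  assumes "\<And>i. i \<in> set I \<Longrightarrow> representable d (\<Phi> i)"
  shows "representable d (\<lambda>X. \<Sum>i\<leftarrow>I. \<Phi> i X)"
  using assms by (induction I) (auto intro: representable_zero representable_add)

text \<open>After expansion into words, the shuffle identity turns each product of two coefficients
  into a linear expression again.\<close>

lemma representable_mult:
  assumes "representable d \<Phi>" "representable d \<Psi>"
  shows "representable d (\<lambda>X. \<Phi> X * \<Psi> X)"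
proof -
  obtain x where x: "x \<in> tensor_algebra d" "\<And>X. X \<in> paths d \<Longrightarrow> \<Phi> X = dual_pairing (signature X) x"
    using assms(1) unfolding representable_def by blast
  obtain y where y: "y \<in> tensor_algebra d" "\<And>X. X \<in> paths d \<Longrightarrow> \<Psi> X = dual_pairing (signature X) y"
    using assms(2) unfolding representable_def by blast
  let ?l = Poly_Mapping.lookup
  have "representable d (\<lambda>X. \<Sum>u\<in>Poly_Mapping.keys x. \<Sum>v\<in>Poly_Mapping.keys y.
      \<Sum>w\<leftarrow>shuffle_words (rev u) (rev v). (?l x u * ?l y v) * signature X (rev w))"
  proof (intro representable_sum representable_sum_list representable_word)
    fix u v w assume "u \<in> Poly_Mapping.keys x" "v \<in> Poly_Mapping.keys y"
      "w \<in> set (shuffle_words (rev u) (rev v))"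
    then show "set (rev w) \<subseteq> {..<d}"
      using x(1) y(1) set_shuffle_words[of w "rev u" "rev v"] by (auto simp: tensor_algebra_def)
  qed
  then show ?thesis
  proof (rule representable_cong)
    fix X assume X: "X \<in> paths d"
    show "\<Phi> X * \<Psi> X = (\<Sum>u\<in>Poly_Mapping.keys x. \<Sum>v\<in>Poly_Mapping.keys y.
      \<Sum>w\<leftarrow>shuffle_words (rev u) (rev v). (?l x u * ?l y v) * signature X (rev w))"
      unfolding x(2)[OF X] y(2)[OF X] dual_pairing_def sum_product sum_list_const_mult
        signature_shuffle[OF X, symmetric]
      by (simp add: mult_ac)
  qed
qed

text \<open>The analogue of a morphism of varieties: every signature coefficient of the image is a
  regular function on the source.\<close>

definition representable_map :: "nat \<Rightarrow> nat \<Rightarrow> (path \<Rightarrow> path) \<Rightarrow> bool" where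
  "representable_map m d F \<longleftrightarrow> F \<in> paths m \<rightarrow> paths d \<and>
     (\<forall>w. set w \<subseteq> {..<d} \<longrightarrow> representable m (\<lambda>X. signature (F X) w))"

lemma representable_map_concat:
  assumes F: "representable_map m d F" and G: "representable_map m d G"
  shows "representable_map m d (\<lambda>X. F X \<squnion>\<^sub>p G X)"
  unfolding representable_map_def
proof (intro conjI allI impI)
  have paths: "F \<in> paths m \<rightarrow> paths d" "G \<in> paths m \<rightarrow> paths d"
    using F G unfolding representable_map_def by blast+
  then show "(\<lambda>X. F X \<squnion>\<^sub>p G X) \<in> paths m \<rightarrow> paths d"
    by (intro Pi_I paths_concat) (rule funcset_mem, assumption+)+
  fix w :: "nat list" assume w: "set w \<subseteq> {..<d}"
  have "representable m (\<lambda>X. \<Sum>k\<le>length w. signature (F X) (take k w) * signature (G X) (drop k w))"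
  proof (intro representable_sum representable_mult)
    fix k
    have "set (take k w) \<subseteq> {..<d}" "set (drop k w) \<subseteq> {..<d}"
      using w set_take_subset[of k w] set_drop_subset[of k w] by auto
    then show "representable m (\<lambda>X. signature (F X) (take k w))"
      "representable m (\<lambda>X. signature (G X) (drop k w))"
      using F G unfolding representable_map_def by blast+
  qed
  then show "representable m (\<lambda>X. signature (F X \<squnion>\<^sub>p G X) w)"
  proof (rule representable_cong)
    fix X assume "X \<in> paths m"
    then have "F X \<in> paths d" "G X \<in> paths d" using paths by auto
    then show "signature (F X \<squnion>\<^sub>p G X) w =
        (\<Sum>k\<le>length w. signature (F X) (take k w) * signature (G X) (drop k w))"
      by (rule signature_concat)
  qed
qed

text \<open>The induction appends at the right end because \<open>path_concat_list\<close> nests to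
  the left. A list of maps covers both claims: copies of the identity, or the component
  maps.\<close>

lemma representable_map_concat_list:
  assumes "Fs \<noteq> []" "\<And>F. F \<in> set Fs \<Longrightarrow> representable_map m d F"
  shows "representable_map m d (\<lambda>X. path_concat_list (map (\<lambda>F. F X) Fs))"
  using assms
proof (induction Fs rule: rev_nonempty_induct)
  case (single F)
  then show ?case by (simp add: path_concat_list_def)
next
  case (snoc F Fs)
  have "path_concat_list (map (\<lambda>F. F X) (Fs @ [F])) = path_concat_list (map (\<lambda>F. F X) Fs) \<squnion>\<^sub>p F X" for X
    using snoc.hyps by (cases Fs) (simp_all add: path_concat_list_def)
  then show ?case
    using representable_map_concat[of m d "\<lambda>X. path_concat_list (map (\<lambda>F. F X) Fs)" F] snoc
    by simp
qed

text \<open>Each defining equation \<open>x\<close>, pulled back along \<open>F\<close>, is again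
  linear in the signature, given by some \<open>f x\<close>; these elements cut out the
  preimage.\<close>

lemma path_variety_vimage:
  assumes F: "representable_map m d F" and V: "path_variety d V"
  shows "path_variety m {X \<in> paths m. F X \<in> V}"
proof -
  obtain W where W: "W \<subseteq> tensor_algebra d" "V = path_variety_of d W"
    using V unfolding path_variety_def by blast
  have "representable m (\<lambda>X. dual_pairing (signature (F X)) x)" if "x \<in> W" for x
  proof -
    have "representable m (\<lambda>X. Poly_Mapping.lookup x w * signature (F X) w)"
      if "w \<in> Poly_Mapping.keys x" for w
    proof -
      have "representable m (\<lambda>X. signature (F X) w)"
        using F W(1) \<open>x \<in> W\<close> that unfolding representable_map_def tensor_algebra_def by blast
      \<comment> \<open>The scalar is attached to the coefficient of the empty word, which is 1, so
        that scaling is a case of \<open>representable_mult\<close>.\<close>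
      moreover have "representable m (\<lambda>X. Poly_Mapping.lookup x w * signature X [])"
        by (rule representable_word) simp
      ultimately have "representable m
          (\<lambda>X. (Poly_Mapping.lookup x w * signature X []) * signature (F X) w)"
        by (rule representable_mult[rotated])
      then show ?thesis by (simp add: signature_def)
    qed
    then show ?thesis unfolding dual_pairing_def by (rule representable_sum)
  qed
  then have "\<forall>x\<in>W. \<exists>y\<in>tensor_algebra m. \<forall>X\<in>paths m.
      dual_pairing (signature (F X)) x = dual_pairing (signature X) y"
    unfolding representable_def by blast
  then obtain f where f: "\<And>x. x \<in> W \<Longrightarrow> f x \<in> tensor_algebra m"
    "\<And>x X. x \<in> W \<Longrightarrow> X \<in> paths m \<Longrightarrow> dual_pairing (signature (F X)) x = dual_pairing (signature X) (f x)"
    by metis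
  have "{X \<in> paths m. F X \<in> V} = path_variety_of m (f ` W)"
    using F unfolding W(2) path_variety_of_def representable_map_def by (auto simp: f(2))
  then show ?thesis using f(1) unfolding path_variety_def by blast
qed

section \<open>The identity and the component maps\<close>

lemma representable_map_id: "representable_map d d (\<lambda>X. X)"
  using representable_word[where c = 1] by (auto simp: representable_map_def)

text \<open>Tags and cell ends stay in [a,b]. This matters because a path has no meaningful values
  outside its time interval.\<close>

lemma rs_integral_cong:
  assumes "\<And>t. a \<le> t \<Longrightarrow> t \<le> b \<Longrightarrow> f t = f' t" "\<And>t. a \<le> t \<Longrightarrow> t \<le> b \<Longrightarrow> g t = g' t"
  shows "rs_integral f g a b = rs_integral f' g' a b"
proof -
  have sums: "(\<Sum>(x, K)\<in>P. f x * (g (Sup K) - g (Inf K))) = (\<Sum>(x, K)\<in>P. f' x * (g' (Sup K) - g' (Inf K)))"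
    if P: "P tagged_division_of {a..b}" for P
  proof (rule sum.cong, safe)
    fix x K assume xK: "(x, K) \<in> P"
    obtain s t where "K = {s..t}" "x \<in> K" "K \<subseteq> {a..b}"
      using tagged_division_ofD(2-4)[OF P xK] by auto
    then show "f x * (g (Sup K) - g (Inf K)) = f' x * (g' (Sup K) - g' (Inf K))"
      using assms by auto
  qed
  then have "has_rs_integral f g a b = has_rs_integral f' g' a b"
    unfolding has_rs_integral_def fun_eq_iff by (simp only: sums simp_thms cong: conj_cong imp_cong)
  then show ?thesis unfolding rs_integral_def by simp
qed

lemma iterated_integral_component:
  assumes "set w \<subseteq> {..<d}" "0 \<le> t" "t \<le> end_time X"
  shows "iterated_integral (path_component_at d k X) w t = iterated_integral X (map (\<lambda>i. k * d + i) w) t"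
  using assms
  by (induction w arbitrary: t) (auto intro!: rs_integral_cong simp: path_component_at_def)

text \<open>A component inherits the control of the whole path, and its signature coefficients are
  those of the whole path with letters shifted by \<open>k * d\<close>.\<close>

lemma representable_map_component:
  assumes k: "k < n"
  shows "representable_map (n * d) d (path_component_at d k)"
  unfolding representable_map_def
proof (intro conjI allI impI)
  show "path_component_at d k \<in> paths (n * d) \<rightarrow> paths d"
  proof
    fix X assume X: "X \<in> paths (n * d)"
    obtain \<phi> \<alpha> where c: "path_control X \<phi> \<alpha>" "\<alpha> \<le> 1" using X by (rule paths_control)
    interpret path_control X \<phi> \<alpha> by fact
    have end_time: "end_time (path_component_at d k X) = end_time X"
      by (simp add: path_component_at_def)
    have "holder (\<lambda>t. path_at (path_component_at d k X) t i)" for i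
    proof (cases "i < d")
      case True
      then show ?thesis
        by (intro control_bound_subst[OF holder_path[of "k * d + i"]]) (simp add: path_component_at_def)
    next
      case False
      then show ?thesis
        by (intro control_bound_subst[OF holder_const[of 0]]) (simp add: path_component_at_def)
    qed
    then have "path_control (path_component_at d k X) \<phi> \<alpha>"
      using le strict cont alpha by unfold_locales (simp_all add: end_time)
    then show "path_component_at d k X \<in> paths d"
    proof (rule pathsI[OF _ c(2)])
      show "0 < end_time (path_component_at d k X)"
        using X by (simp add: end_time paths_def)
    qed (auto simp: path_component_at_def rvec_def)
  qed
  fix w :: "nat list" assume w: "set w \<subseteq> {..<d}"
  have "k * d + i < n * d" if "i < d" for i
  proof -
    have "k * d + i < Suc k * d" using that by simp
    also have "\<dots> \<le> n * d" using k by (intro mult_right_mono) auto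
    finally show ?thesis .
  qed
  then have "representable (n * d) (\<lambda>X. 1 * signature X (map (\<lambda>i. k * d + i) w))"
    using w by (intro representable_word) auto
  then show "representable (n * d) (\<lambda>X. signature (path_component_at d k X) w)"
  proof (rule representable_cong)
    fix X assume "X \<in> paths (n * d)"
    then show "signature (path_component_at d k X) w = 1 * signature X (map (\<lambda>i. k * d + i) w)"
      using iterated_integral_component[of "rev w" d "end_time X" X k] w
      by (simp add: signature_def rev_map path_component_at_def paths_def)
  qed
qed

theorem theorem2p3:
  fixes d n :: nat and V :: "path set"
  assumes "n \<ge> 1" and "path_variety d V"
  shows "path_variety d {X \<in> paths d. path_power n X \<in> V} \<and>
         path_variety (n * d)
           {X \<in> paths (n * d).
              path_concat_list (map (\<lambda>k. path_component_at d k X) [0..<n]) \<in> V}"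
proof
  have "representable_map d d (\<lambda>X. path_concat_list (map (\<lambda>F. F X) (replicate n (\<lambda>X. X))))"
    using assms(1) by (intro representable_map_concat_list) (auto simp: representable_map_id)
  then have "representable_map d d (path_power n)"
    by (simp add: path_power_def[abs_def])
  then show "path_variety d {X \<in> paths d. path_power n X \<in> V}"
    using assms(2) by (rule path_variety_vimage)
  have "representable_map (n * d) d
      (\<lambda>X. path_concat_list (map (\<lambda>F. F X) (map (path_component_at d) [0..<n])))"
    using assms(1) by (intro representable_map_concat_list) (auto intro: representable_map_component)
  then have "representable_map (n * d) d (\<lambda>X. path_concat_list (map (\<lambda>k. path_component_at d k X) [0..<n]))"
    by (simp add: o_def)
  then show "path_variety (n * d)
      {X \<in> paths (n * d). path_concat_list (map (\<lambda>k. path_component_at d k X) [0..<n]) \<in> V}"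
    using assms(2) by (rule path_variety_vimage)
qed

end
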